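(* Let $K$ be an algebraically closed field of characteristic zero, let $Q$ be a connected affine algebraic group over $K$, and let $\mathfrak q=\mathrm{Lie}\,Q$. If $\mathrm{ind}\,\mathfrak q=1$ and $\mathcal S(\mathfrak q)^{\mathfrak q}=K[F]$ for a non-constant $F$, then $\mathfrak q$ is contact.
   Context: A finite-dimensional Lie algebra $\mathfrak q$ is called contact if $\dim\mathfrak q=2n+1$ is odd and there is $\alpha\in\mathfrak q^*$ with $(d_{\mathfrak q}\alpha)^{\wedge n}\wedge\alpha\neq 0$, where $d_{\mathfrak q}\alpha\in\wedge^2\mathfrak q^*$ is the Chevalley--Eilenberg differential, $d_{\mathfrak q}\alpha(\xi,\eta)=-\alpha([\xi,\eta])$ (up to an irrelevant sign convention). The index is $\mathrm{ind}\,\mathfrak q=\min_{\gamma\in\mathfrak q^*}\dim\mathfrak q_\gamma$, where $\mathfrak q_\gamma=\{\xi\in\mathfrak q\mid\gamma([\xi,\mathfrak q])=0\}$. $\mathcal S(\mathfrak q)=K[\mathfrak q^*]$ is the symmetric algebra, on which $\mathfrak q$ acts by derivations extending the adjoint action, and $\mathcal S(\mathfrak q)^{\mathfrak q}=\{F\in\mathcal S(\mathfrak q)\mid\xi\cdot F=0\ \forall\xi\in\mathfrak q\}$ is the ring of symmetric invariants. *)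

theory Defs
  imports
    "HOL-Analysis.Analysis"
    "HOL-Algebra.Group"
    "HOL-Computational_Algebra.Polynomial"
    "HOL-Combinatorics.Permutations"
    "HOL-Library.Function_Algebras"
begin

section \<open>Algebras of functions\<close>

text \<open>
  A function on a set \<open>X\<close> is represented by a function on the ambient type that vanishes off \<open>X\<close>.
  The pointwise operations of \<^theory>\<open>HOL-Library.Function_Algebras\<close> preserve this, so that such
  functions form a vector space with the operations of the ambient type.
\<close>

definition on_set :: "'x set \<Rightarrow> ('x \<Rightarrow> 'k) \<Rightarrow> 'x \<Rightarrow> 'k::zero" where
  "on_set X f = (\<lambda>x. if x \<in> X then f x else 0)"

definition fun_scale :: "'k::times \<Rightarrow> ('x \<Rightarrow> 'k) \<Rightarrow> 'x \<Rightarrow> 'k" where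
  "fun_scale c f = (\<lambda>x. c * f x)"

text \<open>The unital algebra of functions on \<open>X\<close> generated by the restrictions to \<open>X\<close> of the functions
  in \<open>S\<close>.\<close>

inductive_set fun_alg :: "'x set \<Rightarrow> ('x \<Rightarrow> 'k::comm_ring_1) set \<Rightarrow> ('x \<Rightarrow> 'k) set"
  for X :: "'x set" and S :: "('x \<Rightarrow> 'k) set" where
  const: "on_set X (\<lambda>_. c) \<in> fun_alg X S"
| gen: "g \<in> S \<Longrightarrow> on_set X g \<in> fun_alg X S"
| add: "f \<in> fun_alg X S \<Longrightarrow> g \<in> fun_alg X S \<Longrightarrow> f + g \<in> fun_alg X S"
| mult: "f \<in> fun_alg X S \<Longrightarrow> g \<in> fun_alg X S \<Longrightarrow> f * g \<in> fun_alg X S"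

text \<open>Derivations of an algebra \<open>A\<close> of functions, extended by \<open>0\<close> off \<open>A\<close>.\<close>

definition derivations :: "('x \<Rightarrow> 'k::comm_ring_1) set \<Rightarrow> (('x \<Rightarrow> 'k) \<Rightarrow> 'x \<Rightarrow> 'k) set" where
  "derivations A = {D.
     (\<forall>f\<in>A. D f \<in> A) \<and>
     (\<forall>f\<in>A. \<forall>g\<in>A. D (f + g) = D f + D g) \<and>
     (\<forall>c. \<forall>f\<in>A. D (fun_scale c f) = fun_scale c (D f)) \<and>
     (\<forall>f\<in>A. \<forall>g\<in>A. D (f * g) = D f * g + f * D g) \<and>
     (\<forall>f. f \<notin> A \<longrightarrow> D f = 0)}"

lemma fun_scale_0: "fun_scale (c::'k::comm_ring_1) 0 = 0"
  by (simp add: fun_scale_def fun_eq_iff)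

lemma fun_scale_diff: "fun_scale (c::'k::comm_ring_1) (f - g) = fun_scale c f - fun_scale c g"
  by (simp add: fun_scale_def fun_eq_iff algebra_simps)

lemma fun_alg_zero: "0 \<in> fun_alg X S"
proof -
  have "0 = on_set X (\<lambda>_. 0)" by (auto simp: on_set_def fun_eq_iff)
  then show ?thesis by (metis fun_alg.const)
qed

lemma fun_alg_off: "f \<in> fun_alg X S \<Longrightarrow> x \<notin> X \<Longrightarrow> f x = 0"
  by (induction rule: fun_alg.induct) (auto simp: on_set_def)

lemma fun_alg_scale: assumes "f \<in> fun_alg X S" shows "fun_scale c f \<in> fun_alg X S"
proof -
  have "fun_scale c f = on_set X (\<lambda>_. c) * f"
    using fun_alg_off[OF assms] by (auto simp: on_set_def fun_scale_def fun_eq_iff)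
  with assms show ?thesis by (metis fun_alg.const fun_alg.mult)
qed

lemma fun_alg_diff: assumes "f \<in> fun_alg X S" "g \<in> fun_alg X S" shows "f - g \<in> fun_alg X S"
proof -
  have "f - g = f + fun_scale (-1) g" by (auto simp: fun_scale_def fun_eq_iff)
  with assms show ?thesis by (metis fun_alg_scale fun_alg.add)
qed

lemma fun_alg_sum: "(\<And>i. i \<in> I \<Longrightarrow> f i \<in> fun_alg X S) \<Longrightarrow> sum f I \<in> fun_alg X S"
  by (induction I rule: infinite_finite_induct) (auto simp: fun_alg_zero intro: fun_alg.add)

lemma derivationsD:
  assumes "D \<in> derivations A"
  shows "f \<in> A \<Longrightarrow> D f \<in> A"
    and "f \<in> A \<Longrightarrow> g \<in> A \<Longrightarrow> D (f + g) = D f + D g"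
    and "f \<in> A \<Longrightarrow> D (fun_scale c f) = fun_scale c (D f)"
    and "f \<in> A \<Longrightarrow> g \<in> A \<Longrightarrow> D (f * g) = D f * g + f * D g"
    and "f \<notin> A \<Longrightarrow> D f = 0"
  using assms by (auto simp: derivations_def)

lemma derivation_const:
  fixes D :: "('x \<Rightarrow> 'k::field) \<Rightarrow> 'x \<Rightarrow> 'k"
  assumes D: "D \<in> derivations (fun_alg X S)"
  shows "D (on_set X (\<lambda>_. c)) = 0"
proof -
  let ?e = "on_set X (\<lambda>_. 1) :: 'x \<Rightarrow> 'k"
  have e: "?e \<in> fun_alg X S" by (rule fun_alg.const)
  have "?e * ?e = ?e" by (auto simp: on_set_def fun_eq_iff)
  then have "D ?e = D ?e * ?e + ?e * D ?e" using derivationsD(4)[OF D e e] by simp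
  moreover have "D ?e * ?e = D ?e" "?e * D ?e = D ?e"
    using fun_alg_off[OF derivationsD(1)[OF D e]] by (auto simp: on_set_def fun_eq_iff)
  ultimately have "D ?e = 0" by simp
  moreover have "on_set X (\<lambda>_. c) = fun_scale c ?e"
    by (auto simp: on_set_def fun_scale_def fun_eq_iff)
  ultimately show ?thesis using derivationsD(3)[OF D e, of c]
    by (simp add: fun_scale_0)
qed

lemma derivation_eqI:
  fixes D :: "('x \<Rightarrow> 'k::field) \<Rightarrow> 'x \<Rightarrow> 'k"
  assumes D: "D \<in> derivations (fun_alg X S)" and E: "E \<in> derivations (fun_alg X S)"
    and eq: "\<And>g. g \<in> S \<Longrightarrow> D (on_set X g) = E (on_set X g)"
  shows "D = E"
proof
  fix f show "D f = E f"
  proof (cases "f \<in> fun_alg X S")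
    case True
    then show ?thesis
    proof (induction rule: fun_alg.induct)
      case (const c) show ?case using derivation_const[OF D] derivation_const[OF E] by simp
    next
      case (gen g) then show ?case by (rule eq)
    next
      case (add f g) then show "D (f + g) = E (f + g)"
        using derivationsD(2)[OF D] derivationsD(2)[OF E] by simp
    next
      case (mult f g) then show "D (f * g) = E (f * g)"
        using derivationsD(4)[OF D] derivationsD(4)[OF E] by simp
    qed
  next
    case False then show ?thesis using derivationsD(5)[OF D] derivationsD(5)[OF E] by simp
  qed
qed


section \<open>Exterior products of alternating forms\<close>

text \<open>
  A form of degree \<open>p\<close> on a vector space is a function of sequences of vectors that depends only on
  the first \<open>p\<close> entries.
\<close>

definition wedge ::
  "nat \<Rightarrow> nat \<Rightarrow> ((nat \<Rightarrow> 'v) \<Rightarrow> 'k) \<Rightarrow> ((nat \<Rightarrow> 'v) \<Rightarrow> 'k) \<Rightarrow> (nat \<Rightarrow> 'v) \<Rightarrow> 'k::field_char_0" where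
  "wedge p q \<omega> \<eta> = (\<lambda>v. inverse (fact p * fact q) *
     (\<Sum>\<sigma> | \<sigma> permutes {..<p + q}.
        of_int (sign \<sigma>) * \<omega> (\<lambda>i. v (\<sigma> i)) * \<eta> (\<lambda>i. v (\<sigma> (p + i)))))"

primrec wedge_power :: "nat \<Rightarrow> ((nat \<Rightarrow> 'v) \<Rightarrow> 'k) \<Rightarrow> nat \<Rightarrow> (nat \<Rightarrow> 'v) \<Rightarrow> 'k::field_char_0" where
  "wedge_power p \<omega> 0 = (\<lambda>_. 1)"
| "wedge_power p \<omega> (Suc n) = wedge (n * p) p (wedge_power p \<omega> n) \<omega>"


section \<open>Lie algebras\<close>

locale fin_dim_lie_algebra = vector_space scale
  for scale :: "'k::field_char_0 \<Rightarrow> 'v::ab_group_add \<Rightarrow> 'v" +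
  fixes L :: "'v set" and br :: "'v \<Rightarrow> 'v \<Rightarrow> 'v"
  assumes subspace_L: "subspace L"
    and finite_dim_L: "\<exists>B. finite B \<and> L \<subseteq> span B"
    and br_closed: "x \<in> L \<Longrightarrow> y \<in> L \<Longrightarrow> br x y \<in> L"
    and br_add_left: "x \<in> L \<Longrightarrow> y \<in> L \<Longrightarrow> z \<in> L \<Longrightarrow> br (x + y) z = br x z + br y z"
    and br_add_right: "x \<in> L \<Longrightarrow> y \<in> L \<Longrightarrow> z \<in> L \<Longrightarrow> br x (y + z) = br x y + br x z"
    and br_scale_left: "x \<in> L \<Longrightarrow> y \<in> L \<Longrightarrow> br (scale c x) y = scale c (br x y)"
    and br_scale_right: "x \<in> L \<Longrightarrow> y \<in> L \<Longrightarrow> br x (scale c y) = scale c (br x y)"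
    and br_alternating: "x \<in> L \<Longrightarrow> br x x = 0"
    and jacobi: "x \<in> L \<Longrightarrow> y \<in> L \<Longrightarrow> z \<in> L \<Longrightarrow> br x (br y z) + br y (br z x) + br z (br x y) = 0"
begin

text \<open>Linear forms on \<open>L\<close>, extended by \<open>0\<close> off \<open>L\<close>.\<close>

definition dual :: "('v \<Rightarrow> 'k) set" where
  "dual = {\<gamma>. (\<forall>x\<in>L. \<forall>y\<in>L. \<gamma> (x + y) = \<gamma> x + \<gamma> y) \<and> (\<forall>c. \<forall>x\<in>L. \<gamma> (scale c x) = c * \<gamma> x) \<and>
              (\<forall>x. x \<notin> L \<longrightarrow> \<gamma> x = 0)}"

definition stabiliser :: "('v \<Rightarrow> 'k) \<Rightarrow> 'v set" where
  "stabiliser \<gamma> = {\<xi> \<in> L. \<forall>\<eta>\<in>L. \<gamma> (br \<xi> \<eta>) = 0}"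

definition ind :: nat where
  "ind = (INF \<gamma>\<in>dual. dim (stabiliser \<gamma>))"

definition differential :: "('v \<Rightarrow> 'k) \<Rightarrow> (nat \<Rightarrow> 'v) \<Rightarrow> 'k" where
  "differential \<alpha> = (\<lambda>v. - \<alpha> (br (v 0) (v 1)))"

definition contact :: bool where
  "contact \<longleftrightarrow> (\<exists>n. dim L = 2 * n + 1 \<and>
     (\<exists>\<alpha>\<in>dual. \<exists>v. (\<forall>i. v i \<in> L) \<and>
        wedge (n * 2) 1 (wedge_power 2 (differential \<alpha>) n) (\<lambda>v. \<alpha> (v 0)) v \<noteq> 0))"

text \<open>
  Over an infinite field the symmetric algebra of \<open>L\<close> is the algebra of polynomial functions on the
  dual space; an element of \<open>L\<close> acts as evaluation.
\<close>

definition ev :: "'v \<Rightarrow> ('v \<Rightarrow> 'k) \<Rightarrow> 'k" where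
  "ev \<xi> = on_set dual (\<lambda>\<gamma>. \<gamma> \<xi>)"

definition sym_alg :: "(('v \<Rightarrow> 'k) \<Rightarrow> 'k) set" where
  "sym_alg = fun_alg dual (ev ` L)"

definition sym_act :: "'v \<Rightarrow> (('v \<Rightarrow> 'k) \<Rightarrow> 'k) \<Rightarrow> ('v \<Rightarrow> 'k) \<Rightarrow> 'k" where
  "sym_act \<xi> = (THE D. D \<in> derivations sym_alg \<and> (\<forall>\<eta>\<in>L. D (ev \<eta>) = ev (br \<xi> \<eta>)))"

definition sym_invariants :: "(('v \<Rightarrow> 'k) \<Rightarrow> 'k) set" where
  "sym_invariants = {F \<in> sym_alg. \<forall>\<xi>\<in>L. sym_act \<xi> F = 0}"

lemma on_set_ev: "on_set dual (ev \<eta>) = ev \<eta>"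
  by (auto simp: ev_def on_set_def)

lemma sym_act_ex1:
  assumes \<xi>: "\<xi> \<in> L"
  shows "\<exists>!D. D \<in> derivations sym_alg \<and> (\<forall>\<eta>\<in>L. D (ev \<eta>) = ev (br \<xi> \<eta>))"
proof (rule ex_ex1I)
  define \<delta> where "\<delta> \<gamma> = on_set L (\<lambda>x. \<gamma> (br \<xi> x))" for \<gamma> :: "'v \<Rightarrow> 'k"
  have \<delta>: "\<delta> \<gamma> \<in> dual" if "\<gamma> \<in> dual" for \<gamma>
    using that \<xi> br_closed[OF \<xi>] br_add_right[OF \<xi>] br_scale_right[OF \<xi>]
      subspace_add[OF subspace_L] subspace_scale[OF subspace_L]
    by (auto simp: dual_def \<delta>_def on_set_def)
  have line: "\<gamma> + fun_scale t \<gamma>' \<in> dual" if "\<gamma> \<in> dual" "\<gamma>' \<in> dual" for \<gamma> \<gamma>' t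
    using that by (auto simp: dual_def fun_scale_def algebra_simps)
  define P where "P F \<gamma> p \<longleftrightarrow> (\<forall>t. F (\<gamma> + fun_scale t (\<delta> \<gamma>)) = poly p t)"
    for F :: "('v \<Rightarrow> 'k) \<Rightarrow> 'k" and \<gamma> and p :: "'k poly"
  have ex: "\<exists>p. P F \<gamma> p" if "F \<in> sym_alg" "\<gamma> \<in> dual" for F \<gamma>
    using that(1) unfolding sym_alg_def
  proof (induction rule: fun_alg.induct)
    case (const c)
    have "P (on_set dual (\<lambda>_. c)) \<gamma> [:c:]"
      using line[OF that(2) \<delta>[OF that(2)]] by (auto simp: P_def on_set_def)
    then show ?case by blast
  next
    case (gen g)
    then obtain \<eta> where g: "g = ev \<eta>" by auto
    have "P (on_set dual g) \<gamma> [:\<gamma> \<eta>, \<delta> \<gamma> \<eta>:]"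
      using line[OF that(2) \<delta>[OF that(2)]] by (auto simp: P_def on_set_def g ev_def fun_scale_def)
    then show ?case by blast
  next
    case (add f g)
    then obtain p q where "P f \<gamma> p" "P g \<gamma> q" by auto
    then have "P (f + g) \<gamma> (p + q)" by (auto simp: P_def)
    then show ?case by blast
  next
    case (mult f g)
    then obtain p q where "P f \<gamma> p" "P g \<gamma> q" by auto
    then have "P (f * g) \<gamma> (p * q)" by (auto simp: P_def)
    then show ?case by blast
  qed
  have uniq: "p = q" if "P F \<gamma> p" "P F \<gamma> q" for F \<gamma> p q
    using that by (simp add: P_def poly_eq_poly_eq_iff[symmetric] fun_eq_iff)
  define D where "D F = (if F \<in> sym_alg then on_set dual (\<lambda>\<gamma>. coeff (THE p. P F \<gamma> p) 1) else 0)" for F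
  have D_eq: "D F \<gamma> = coeff p 1" if "F \<in> sym_alg" "\<gamma> \<in> dual" "P F \<gamma> p" for F \<gamma> p
  proof -
    have "(THE p. P F \<gamma> p) = p" using that(3) uniq[OF _ that(3)] by (rule the_equality)
    then show ?thesis using that(1,2) by (simp add: D_def on_set_def)
  qed
  have P_0: "coeff p 0 = F \<gamma>" if "P F \<gamma> p" for F \<gamma> p
  proof -
    have "F (\<gamma> + fun_scale 0 (\<delta> \<gamma>)) = poly p 0" using that by (simp add: P_def)
    moreover have "\<gamma> + fun_scale 0 (\<delta> \<gamma>) = \<gamma>" by (simp add: fun_scale_def fun_eq_iff)
    ultimately show ?thesis by (simp add: poly_0_coeff_0)
  qed
  have D_off: "D F \<gamma> = 0" if "\<gamma> \<notin> dual" for F \<gamma>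
    using that by (auto simp: D_def on_set_def)
  have closed: "F + G \<in> sym_alg" "F * G \<in> sym_alg" "fun_scale c F \<in> sym_alg"
    if "F \<in> sym_alg" "G \<in> sym_alg" for F G c
    using that by (auto simp: sym_alg_def fun_alg.add fun_alg.mult fun_alg_scale)
  have D_add: "D (F + G) = D F + D G" if FG: "F \<in> sym_alg" "G \<in> sym_alg" for F G
  proof
    fix \<gamma> show "D (F + G) \<gamma> = (D F + D G) \<gamma>"
    proof (cases "\<gamma> \<in> dual")
      case True
      then obtain p q where pq: "P F \<gamma> p" "P G \<gamma> q" using ex FG by blast
      then have "P (F + G) \<gamma> (p + q)" by (auto simp: P_def)
      then show ?thesis
        using D_eq[OF closed(1)[OF FG] True] D_eq[OF FG(1) True pq(1)] D_eq[OF FG(2) True pq(2)]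
        by simp
    qed (simp add: D_off)
  qed
  have D_mult: "D (F * G) = D F * G + F * D G" if FG: "F \<in> sym_alg" "G \<in> sym_alg" for F G
  proof
    fix \<gamma> show "D (F * G) \<gamma> = (D F * G + F * D G) \<gamma>"
    proof (cases "\<gamma> \<in> dual")
      case True
      then obtain p q where pq: "P F \<gamma> p" "P G \<gamma> q" using ex FG by blast
      then have "P (F * G) \<gamma> (p * q)" by (auto simp: P_def)
      then have "D (F * G) \<gamma> = coeff (p * q) 1" using D_eq[OF closed(2)[OF FG] True] by blast
      also have "\<dots> = coeff p 1 * coeff q 0 + coeff p 0 * coeff q 1"
        by (simp add: coeff_mult)
      finally show ?thesis
        using D_eq[OF FG(1) True pq(1)] D_eq[OF FG(2) True pq(2)] P_0[OF pq(1)] P_0[OF pq(2)]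
        by simp
    qed (simp add: D_off)
  qed
  have D_scale: "D (fun_scale c F) = fun_scale c (D F)" if F: "F \<in> sym_alg" for F c
  proof
    fix \<gamma> show "D (fun_scale c F) \<gamma> = fun_scale c (D F) \<gamma>"
    proof (cases "\<gamma> \<in> dual")
      case True
      then obtain p where p: "P F \<gamma> p" using ex F by blast
      then have "P (fun_scale c F) \<gamma> (smult c p)" by (auto simp: P_def fun_scale_def)
      then show ?thesis
        using D_eq[OF closed(3)[OF F F] True] D_eq[OF F True p] by (simp add: fun_scale_def)
    qed (simp add: D_off fun_scale_def)
  qed
  have ev_in: "ev \<eta> \<in> sym_alg" if "\<eta> \<in> L" for \<eta>
    using fun_alg.gen[of "ev \<eta>" "ev ` L" dual] that by (simp add: sym_alg_def on_set_ev)
  have D_ev: "D (ev \<eta>) = ev (br \<xi> \<eta>)" if "\<eta> \<in> L" for \<eta>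
  proof
    fix \<gamma> show "D (ev \<eta>) \<gamma> = ev (br \<xi> \<eta>) \<gamma>"
    proof (cases "\<gamma> \<in> dual")
      case True
      have "P (ev \<eta>) \<gamma> [:\<gamma> \<eta>, \<delta> \<gamma> \<eta>:]"
        using line[OF True \<delta>[OF True]] by (auto simp: P_def on_set_def ev_def fun_scale_def)
      then have "D (ev \<eta>) \<gamma> = \<delta> \<gamma> \<eta>" using D_eq[OF ev_in[OF that] True, of "[:\<gamma> \<eta>, \<delta> \<gamma> \<eta>:]"] by simp
      then show ?thesis using that True by (simp add: \<delta>_def on_set_def ev_def)
    qed (simp add: D_off ev_def on_set_def)
  qed
  have D_const: "D (on_set dual (\<lambda>_. c)) = 0" for c
  proof
    fix \<gamma> show "D (on_set dual (\<lambda>_. c)) \<gamma> = 0 \<gamma>"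
    proof (cases "\<gamma> \<in> dual")
      case True
      have "P (on_set dual (\<lambda>_. c)) \<gamma> [:c:]"
        using line[OF True \<delta>[OF True]] by (auto simp: P_def on_set_def)
      then show ?thesis
        using D_eq[OF fun_alg.const[of dual c "ev ` L", folded sym_alg_def] True, of "[:c:]"] by simp
    qed (simp add: D_off)
  qed
  have D_in: "D F \<in> sym_alg" if "F \<in> sym_alg" for F
    using that unfolding sym_alg_def
  proof (induction rule: fun_alg.induct)
    case (const c) show "D (on_set dual (\<lambda>_. c)) \<in> fun_alg dual (ev ` L)"
      unfolding D_const by (rule fun_alg_zero)
  next
    case (gen g)
    then obtain \<eta> where "g = ev \<eta>" "\<eta> \<in> L" by auto
    then show ?case using ev_in[OF br_closed[OF \<xi> \<open>\<eta> \<in> L\<close>]] by (simp add: on_set_ev D_ev sym_alg_def)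
  next
    case (add f g)
    then show "D (f + g) \<in> fun_alg dual (ev ` L)" using D_add[of f g] by (simp add: sym_alg_def fun_alg.add)
  next
    case (mult f g)
    then show "D (f * g) \<in> fun_alg dual (ev ` L)" using D_mult[of f g] by (simp add: sym_alg_def fun_alg.add fun_alg.mult)
  qed
  have "D \<in> derivations sym_alg"
    unfolding derivations_def using D_in D_add D_scale D_mult by (simp add: D_def)
  with D_ev show "\<exists>D. D \<in> derivations sym_alg \<and> (\<forall>\<eta>\<in>L. D (ev \<eta>) = ev (br \<xi> \<eta>))" by blast
next
  fix D E
  assume "D \<in> derivations sym_alg \<and> (\<forall>\<eta>\<in>L. D (ev \<eta>) = ev (br \<xi> \<eta>))"
    "E \<in> derivations sym_alg \<and> (\<forall>\<eta>\<in>L. E (ev \<eta>) = ev (br \<xi> \<eta>))"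
  then show "D = E" unfolding sym_alg_def by (intro derivation_eqI[of D dual "ev ` L"]) (auto simp: on_set_ev)
qed

end


section \<open>Affine algebraic groups\<close>

text \<open>
  Over an algebraically closed field of characteristic zero an affine variety is identified with
  its set of points, a Zariski closed subset of an affine space.
\<close>

definition coords :: "(('k::field ^ 'n) \<Rightarrow> 'k) set" where
  "coords = range (\<lambda>i x. x $ i)"

definition zariski_closed :: "('k::field ^ 'n) set \<Rightarrow> bool" where
  "zariski_closed V \<longleftrightarrow> (\<exists>P \<subseteq> fun_alg UNIV coords. V = {x. \<forall>p\<in>P. p x = 0})"

definition zariski :: "('k::field ^ 'n) topology" where
  "zariski = topology (\<lambda>U. zariski_closed (- U))"

abbreviation coordinate_ring :: "('k::field ^ 'n) set \<Rightarrow> (('k ^ 'n) \<Rightarrow> 'k) set" where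
  "coordinate_ring V \<equiv> fun_alg V coords"

lemma zariski_closed_Un:
  assumes "zariski_closed V" "zariski_closed W"
  shows "zariski_closed (V \<union> W)"
proof -
  obtain P Q where P: "P \<subseteq> fun_alg UNIV coords" "V = {x. \<forall>p\<in>P. p x = 0}"
    and Q: "Q \<subseteq> fun_alg UNIV coords" "W = {x. \<forall>p\<in>Q. p x = 0}"
    using assms by (auto simp: zariski_closed_def)
  have "V \<union> W = {x. \<forall>r\<in>(\<lambda>(p, q). p * q) ` (P \<times> Q). r x = 0}"
    unfolding P Q by auto
  moreover have "(\<lambda>(p, q). p * q) ` (P \<times> Q) \<subseteq> fun_alg UNIV coords"
    using P Q by (auto intro!: fun_alg.mult)
  ultimately show ?thesis unfolding zariski_closed_def by blast
qed

lemma zariski_closed_Inter: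
  assumes "\<And>V. V \<in> \<V> \<Longrightarrow> zariski_closed V"
  shows "zariski_closed (\<Inter>\<V>)"
proof -
  define I where "I V = {p \<in> fun_alg UNIV coords. \<forall>x\<in>V. p x = 0}" for V :: "('a ^ 'b) set"
  have "\<Inter>\<V> = {x. \<forall>p\<in>\<Union>(I ` \<V>). p x = 0}"
  proof (intro Set.set_eqI iffI)
    fix x assume "x \<in> \<Inter>\<V>"
    then show "x \<in> {x. \<forall>p\<in>\<Union>(I ` \<V>). p x = 0}" by (simp add: I_def)
  next
    fix x assume x: "x \<in> {x. \<forall>p\<in>\<Union>(I ` \<V>). p x = 0}"
    show "x \<in> \<Inter>\<V>"
    proof
      fix V assume V: "V \<in> \<V>"
      obtain P where P: "P \<subseteq> fun_alg UNIV coords" "V = {x. \<forall>p\<in>P. p x = 0}"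
        using assms[OF V] unfolding zariski_closed_def by (elim exE conjE)
      have "p \<in> I V" if "p \<in> P" for p using that P(1) unfolding I_def P(2) by auto
      then have "\<forall>p\<in>P. p x = 0" using x V by simp
      then show "x \<in> V" unfolding P(2) by simp
    qed
  qed
  moreover have "\<Union>(I ` \<V>) \<subseteq> fun_alg UNIV coords" by (auto simp: I_def)
  ultimately show ?thesis unfolding zariski_closed_def by (intro exI conjI)
qed

lemma istopology_zariski: "istopology (\<lambda>U :: ('k::field ^ 'n) set. zariski_closed (- U))"
  unfolding istopology_def
proof (intro conjI allI impI)
  fix S T :: "('k ^ 'n) set" assume "zariski_closed (- S)" "zariski_closed (- T)"
  then show "zariski_closed (- (S \<inter> T))" by (simp add: Compl_Int zariski_closed_Un)
next
  fix \<K> :: "('k ^ 'n) set set" assume "\<forall>K\<in>\<K>. zariski_closed (- K)"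
  then have "zariski_closed (\<Inter>(uminus ` \<K>))" by (intro zariski_closed_Inter) auto
  then show "zariski_closed (- \<Union>\<K>)" by (simp add: uminus_Sup)
qed

lemma openin_zariski: "openin zariski U \<longleftrightarrow> zariski_closed (- U)"
  unfolding zariski_def topology_inverse'[OF istopology_zariski] ..

lemma topspace_zariski [simp]: "topspace zariski = UNIV"
proof -
  have "zariski_closed (- UNIV :: ('a ^ 'b) set)"
    using fun_alg.const[of UNIV 1 coords] unfolding zariski_closed_def
    by (intro exI[of _ "{on_set UNIV (\<lambda>_. 1)}"]) (auto simp: on_set_def)
  then show ?thesis using openin_subset[of zariski UNIV] by (auto simp: openin_zariski)
qed

lemma closedin_zariski: "closedin zariski V \<longleftrightarrow> zariski_closed V"
proof -
  have "- (UNIV - V) = V" by auto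
  then show ?thesis unfolding closedin_def topspace_zariski openin_zariski by simp
qed

text \<open>
  A map into \<open>V \<subseteq> K\<^sup>n\<close> is a morphism iff its components are regular functions; \<open>K[V \<times> V]\<close> is
  generated by the coordinates of both factors.
\<close>

locale affine_algebraic_group = group G
  for G :: "('k::{alg_closed_field, field_char_0} ^ 'n) monoid" (structure) +
  assumes closed_carrier: "closedin zariski (carrier G)"
    and regular_mult: "on_set (carrier G \<times> carrier G) (\<lambda>(x, y). (x \<otimes> y) $ i)
          \<in> fun_alg (carrier G \<times> carrier G) ((\<lambda>f. f \<circ> fst) ` coords \<union> (\<lambda>f. f \<circ> snd) ` coords)"
    and regular_inv: "on_set (carrier G) (\<lambda>x. (inv x) $ i) \<in> coordinate_ring (carrier G)"

definition left_translate ::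
  "('k::field ^ 'n) monoid \<Rightarrow> 'k ^ 'n \<Rightarrow> (('k ^ 'n) \<Rightarrow> 'k) \<Rightarrow> ('k ^ 'n) \<Rightarrow> 'k" where
  "left_translate G g f = on_set (carrier G) (\<lambda>x. f (inv\<^bsub>G\<^esub> g \<otimes>\<^bsub>G\<^esub> x))"

text \<open>The Lie algebra of \<open>G\<close>: left invariant derivations of \<open>K[G]\<close>, with the commutator.\<close>

definition lie :: "('k::field ^ 'n) monoid \<Rightarrow> ((('k ^ 'n) \<Rightarrow> 'k) \<Rightarrow> ('k ^ 'n) \<Rightarrow> 'k) set" where
  "lie G = {D \<in> derivations (coordinate_ring (carrier G)).
     \<forall>g \<in> carrier G. \<forall>f \<in> coordinate_ring (carrier G).
       D (left_translate G g f) = left_translate G g (D f)}"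

definition op_scale :: "'k::times \<Rightarrow> ('f \<Rightarrow> 'x \<Rightarrow> 'k) \<Rightarrow> 'f \<Rightarrow> 'x \<Rightarrow> 'k" where
  "op_scale c D = (\<lambda>f. fun_scale c (D f))"

definition commutator :: "('a \<Rightarrow> 'a) \<Rightarrow> ('a \<Rightarrow> 'a) \<Rightarrow> 'a \<Rightarrow> 'a::minus" where
  "commutator D E = (\<lambda>f. D (E f) - E (D f))"

lemma derivations_commutator:
  fixes X :: "'x set" and S :: "('x \<Rightarrow> 'k::field) set"
  assumes D: "D \<in> derivations (fun_alg X S)" and E: "E \<in> derivations (fun_alg X S)"
  shows "commutator D E \<in> derivations (fun_alg X S)"
  unfolding derivations_def mem_Collect_eq
proof (intro conjI ballI allI impI)
  note d = derivationsD[OF D] and e = derivationsD[OF E]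
  fix f assume f: "f \<in> fun_alg X S"
  show "commutator D E f \<in> fun_alg X S"
    using f d e by (simp add: commutator_def fun_alg_diff)
  show "commutator D E (fun_scale c f) = fun_scale c (commutator D E f)" for c
    using f d e by (simp add: commutator_def fun_scale_diff)
  fix g assume g: "g \<in> fun_alg X S"
  show "commutator D E (f + g) = commutator D E f + commutator D E g"
    using f g d e by (simp add: commutator_def)
  show "commutator D E (f * g) = commutator D E f * g + f * commutator D E g"
    using f g d e by (simp add: commutator_def fun_alg.mult algebra_simps)
next
  fix f assume f: "f \<notin> fun_alg X S"
  have "H 0 = 0" if "H \<in> derivations (fun_alg X S)" for H
    using derivationsD(2)[OF that fun_alg_zero fun_alg_zero] by simp
  then show "commutator D E f = 0"
    using D E derivationsD(5)[OF D f] derivationsD(5)[OF E f] by (simp add: commutator_def)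
qed

interpretation op: vector_space
  "op_scale :: 'k::field \<Rightarrow> ('f \<Rightarrow> 'x \<Rightarrow> 'k) \<Rightarrow> 'f \<Rightarrow> 'x \<Rightarrow> 'k"
  by unfold_locales (auto simp: op_scale_def fun_scale_def fun_eq_iff algebra_simps)

context affine_algebraic_group
begin

abbreviation "KG \<equiv> coordinate_ring (carrier G)"

lemma left_translate_in:
  assumes g: "g \<in> carrier G" and f: "f \<in> KG"
  shows "left_translate G g f \<in> KG"
proof -
  let ?V = "carrier G" let ?h = "inv g"
  have h: "?h \<in> ?V" using g by simp
  have slice: "on_set ?V (\<lambda>x. F (?h, x)) \<in> KG"
    if "F \<in> fun_alg (?V \<times> ?V) ((\<lambda>f. f \<circ> fst) ` coords \<union> (\<lambda>f. f \<circ> snd) ` coords)" for F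
    using that
  proof (induction rule: fun_alg.induct)
    case (const c)
    have "on_set ?V (\<lambda>x. on_set (?V \<times> ?V) (\<lambda>_. c) (?h, x)) = on_set ?V (\<lambda>_. c)"
      using h by (auto simp: on_set_def)
    then show ?case by (simp add: fun_alg.const)
  next
    case (gen u)
    then consider c where "c \<in> coords" "u = c \<circ> fst" | c where "c \<in> coords" "u = c \<circ> snd" by blast
    then show ?case
    proof cases
      case 1
      then have "on_set ?V (\<lambda>x. on_set (?V \<times> ?V) u (?h, x)) = on_set ?V (\<lambda>_. c ?h)"
        using h by (auto simp: on_set_def)
      then show ?thesis by (simp add: fun_alg.const)
    next
      case 2
      then have "on_set ?V (\<lambda>x. on_set (?V \<times> ?V) u (?h, x)) = on_set ?V c"
        using h by (auto simp: on_set_def)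
      then show ?thesis using 2 by (simp add: fun_alg.gen)
    qed
  next
    case (add u w)
    have eq: "on_set ?V (\<lambda>x. (u + w) (?h, x)) = on_set ?V (\<lambda>x. u (?h, x)) + on_set ?V (\<lambda>x. w (?h, x))"
      by (auto simp: on_set_def)
    show "on_set ?V (\<lambda>x. (u + w) (?h, x)) \<in> KG"
      unfolding eq using add.IH by (rule fun_alg.add)
  next
    case (mult u w)
    have eq: "on_set ?V (\<lambda>x. (u * w) (?h, x)) = on_set ?V (\<lambda>x. u (?h, x)) * on_set ?V (\<lambda>x. w (?h, x))"
      by (auto simp: on_set_def)
    show "on_set ?V (\<lambda>x. (u * w) (?h, x)) \<in> KG"
      unfolding eq using mult.IH by (rule fun_alg.mult)
  qed
  show ?thesis using f unfolding left_translate_def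
  proof (induction rule: fun_alg.induct)
    case (const c)
    have "on_set ?V (\<lambda>x. on_set ?V (\<lambda>_. c) (?h \<otimes> x)) = on_set ?V (\<lambda>_. c)"
      using h by (auto simp: on_set_def)
    then show ?case by (simp add: fun_alg.const)
  next
    case (gen u)
    then obtain i where u: "u = (\<lambda>x. x $ i)" by (auto simp: coords_def)
    have "on_set ?V (\<lambda>x. on_set ?V u (?h \<otimes> x))
        = on_set ?V (\<lambda>x. on_set (?V \<times> ?V) (\<lambda>(x, y). (x \<otimes> y) $ i) (?h, x))"
      using h by (auto simp: on_set_def u)
    then show ?case using slice[OF regular_mult[of i]] by simp
  next
    case (add u w)
    have eq: "on_set ?V (\<lambda>x. (u + w) (?h \<otimes> x)) = on_set ?V (\<lambda>x. u (?h \<otimes> x)) + on_set ?V (\<lambda>x. w (?h \<otimes> x))"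
      by (auto simp: on_set_def)
    show "on_set ?V (\<lambda>x. (u + w) (?h \<otimes> x)) \<in> KG"
      unfolding eq using add.IH by (rule fun_alg.add)
  next
    case (mult u w)
    have eq: "on_set ?V (\<lambda>x. (u * w) (?h \<otimes> x)) = on_set ?V (\<lambda>x. u (?h \<otimes> x)) * on_set ?V (\<lambda>x. w (?h \<otimes> x))"
      by (auto simp: on_set_def)
    show "on_set ?V (\<lambda>x. (u * w) (?h \<otimes> x)) \<in> KG"
      unfolding eq using mult.IH by (rule fun_alg.mult)
  qed
qed

lemma lieD:
  assumes "D \<in> lie G"
  shows "D \<in> derivations KG"
    and "g \<in> carrier G \<Longrightarrow> f \<in> KG \<Longrightarrow> D (left_translate G g f) = left_translate G g (D f)"
  using assms by (auto simp: lie_def)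

lemma lie_subspace: "op.subspace (lie G)"
  unfolding op.subspace_def
proof (intro conjI ballI allI)
  show "0 \<in> lie G"
    by (auto simp: lie_def derivations_def fun_alg_zero left_translate_def on_set_def fun_scale_def fun_eq_iff)
next
  fix D E assume D: "D \<in> lie G" and E: "E \<in> lie G"
  then show "D + E \<in> lie G"
    by (auto simp: lie_def derivations_def fun_alg.add left_translate_def on_set_def fun_scale_def
          fun_eq_iff algebra_simps)
next
  fix c D assume D: "D \<in> lie G"
  then show "op_scale c D \<in> lie G"
    by (auto simp: lie_def derivations_def op_scale_def fun_alg_scale)
       (auto simp: left_translate_def on_set_def fun_scale_def fun_eq_iff algebra_simps)
qed

lemma lie_commutator:
  assumes D: "D \<in> lie G" and E: "E \<in> lie G"
  shows "commutator D E \<in> lie G"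
proof -
  note d = lieD[OF D] and e = lieD[OF E]
  have lt: "left_translate G g (u - w) = left_translate G g u - left_translate G g w" for g u w
    by (auto simp: left_translate_def on_set_def fun_eq_iff)
  have "commutator D E (left_translate G g f) = left_translate G g (commutator D E f)"
    if "g \<in> carrier G" "f \<in> KG" for g f
    using that derivationsD(1)[OF d(1)] derivationsD(1)[OF e(1)]
    by (simp add: commutator_def d(2) e(2) lt)
  then show ?thesis using derivations_commutator[OF d(1) e(1)] by (simp add: lie_def)
qed

lemma lie_eq_0:
  assumes D: "D \<in> lie G" and z: "\<And>i. D (on_set (carrier G) (\<lambda>x. x $ i)) \<one> = 0"
  shows "D = 0"
proof
  note d = lieD[OF D] note dd = derivationsD[OF d(1)]
  have at_one: "D f \<one> = 0" if "f \<in> KG" for f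
    using that
  proof (induction rule: fun_alg.induct)
    case (const c) then show ?case using derivation_const[OF d(1)] by simp
  next
    case (gen g) then show ?case using z by (auto simp: coords_def)
  next
    case (add f g) then show "D (f + g) \<one> = 0" using dd(2) by simp
  next
    case (mult f g) then show "D (f * g) \<one> = 0" using dd(4) by simp
  qed
  fix f show "D f = 0 f"
  proof (cases "f \<in> KG")
    case True
    show ?thesis
    proof
      fix x show "D f x = 0 f x"
      proof (cases "x \<in> carrier G")
        case x: True
        have "left_translate G (inv x) (D f) \<one> = D (left_translate G (inv x) f) \<one>"
          using d(2)[of "inv x" f] x True by simp
        also have "\<dots> = 0" using at_one left_translate_in x True by simp
        finally show ?thesis using x by (simp add: left_translate_def on_set_def)
      next
        case False then show ?thesis using fun_alg_off[OF dd(1)[OF True]] by simp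
      qed
    qed
  next
    case False then show ?thesis using dd(5) by simp
  qed
qed

lemma lie_finite_dim: "\<exists>B. finite B \<and> lie G \<subseteq> op.span B"
proof -
  obtain B where B: "B \<subseteq> lie G" "op.independent B" "lie G \<subseteq> op.span B"
    using op.maximal_independent_subset by blast
  define \<Phi> :: "((('k ^ 'n) \<Rightarrow> 'k) \<Rightarrow> ('k ^ 'n) \<Rightarrow> 'k) \<Rightarrow> 'k ^ 'n"
    where "\<Phi> D = (\<chi> i. D (on_set (carrier G) (\<lambda>x. x $ i)) \<one>)" for D
  interpret pr: vector_space_pair
    "op_scale :: 'k \<Rightarrow> ((('k ^ 'n) \<Rightarrow> 'k) \<Rightarrow> ('k ^ 'n) \<Rightarrow> 'k) \<Rightarrow> _" "(*s) :: 'k \<Rightarrow> 'k ^ 'n \<Rightarrow> 'k ^ 'n"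
    by unfold_locales
  have lin: "Vector_Spaces.linear op_scale (*s) \<Phi>"
    by unfold_locales (auto simp: \<Phi>_def vec_eq_iff op_scale_def fun_scale_def)
  have span: "op.span B \<subseteq> lie G" using op.span_minimal[OF B(1) lie_subspace] .
  have inj: "inj_on \<Phi> (op.span B)"
  proof (rule inj_onI)
    fix D E assume DE: "D \<in> op.span B" "E \<in> op.span B" "\<Phi> D = \<Phi> E"
    then have "D - E \<in> lie G" using span op.span_diff by blast
    moreover have "(D - E) (on_set (carrier G) (\<lambda>x. x $ i)) \<one> = 0" for i
      using DE(3) by (simp add: \<Phi>_def vec_eq_iff)
    ultimately have "D - E = 0" by (rule lie_eq_0)
    then show "D = E" by simp
  qed
  have "vec.independent (\<Phi> ` B)"
    using pr.linear_independent_injective_image[OF lin B(2) inj] .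
  then have "finite (\<Phi> ` B)" by (rule vec.finiteI_independent)
  then have "finite B"
    using inj_on_subset[OF inj op.span_superset] finite_imageD by blast
  with B(3) show ?thesis by blast
qed

sublocale lie: fin_dim_lie_algebra op_scale "lie G" commutator
proof unfold_locales
  have dd: "D (u + w) = D u + D w" "D (fun_scale c u) = fun_scale c (D u)" "D u \<in> KG"
    if "D \<in> lie G" "u \<in> KG" "w \<in> KG" for D u w c
    using derivationsD[OF lieD(1)[OF that(1)]] that by auto
  have off: "D u = 0" if "D \<in> lie G" "u \<notin> KG" for D u
    using derivationsD(5)[OF lieD(1)[OF that(1)]] that by auto
  have zero: "D 0 = 0" if "D \<in> lie G" for D
    using dd(1)[OF that fun_alg_zero fun_alg_zero] by simp
  have minus: "D (u - w) = D u - D w" if "D \<in> lie G" "u \<in> KG" "w \<in> KG" for D u w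
    using dd(1)[OF that(1) fun_alg_diff[OF that(2,3)] that(3)] by (simp add: algebra_simps)
  show "op.subspace (lie G)" by (rule lie_subspace)
  show "\<exists>B. finite B \<and> lie G \<subseteq> op.span B" by (rule lie_finite_dim)
  fix x y assume x: "x \<in> lie G" and y: "y \<in> lie G"
  show "commutator x y \<in> lie G" using x y by (rule lie_commutator)
  show "commutator x x = 0" by (simp add: commutator_def fun_eq_iff)
  show "commutator (op_scale c x) y = op_scale c (commutator x y)" for c
  proof
    fix f show "commutator (op_scale c x) y f = op_scale c (commutator x y) f"
    proof (cases "f \<in> KG")
      case True
      then show ?thesis using dd(2)[OF y True True] dd(2)[OF x True True] dd(3)[OF x True True] dd(2)[OF y dd(3)[OF x True True] True]
        by (simp add: commutator_def op_scale_def fun_scale_diff)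
    next
      case False
      then show ?thesis using off[OF x] off[OF y] zero[OF x] zero[OF y]
        by (simp add: commutator_def op_scale_def fun_scale_0)
    qed
  qed
  show "commutator x (op_scale c y) = op_scale c (commutator x y)" for c
  proof
    fix f show "commutator x (op_scale c y) f = op_scale c (commutator x y) f"
    proof (cases "f \<in> KG")
      case True
      then show ?thesis using dd(2)[OF x True True] dd(3)[OF y True True] dd(2)[OF x dd(3)[OF y True True] True]
        by (simp add: commutator_def op_scale_def fun_scale_diff)
    next
      case False
      then show ?thesis using off[OF x] off[OF y] zero[OF x] zero[OF y]
        by (simp add: commutator_def op_scale_def fun_scale_0)
    qed
  qed
  fix z assume z: "z \<in> lie G"
  show "commutator (x + y) z = commutator x z + commutator y z"
  proof
    fix f show "commutator (x + y) z f = (commutator x z + commutator y z) f"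
    proof (cases "f \<in> KG")
      case True
      then show ?thesis using dd[OF z] dd(3)[OF x] dd(3)[OF y] by (simp add: commutator_def)
    next
      case False
      then have 0: "x f = 0" "y f = 0" "z f = 0" using off x y z by auto
      have "commutator (x + y) z f = x 0 + y 0 - z (0 + 0)" by (simp only: commutator_def 0 plus_fun_apply)
      then show ?thesis by (simp add: commutator_def 0 zero[OF x] zero[OF y] zero[OF z] fun_eq_iff)
    qed
  qed
  show "commutator x (y + z) = commutator x y + commutator x z"
  proof
    fix f show "commutator x (y + z) f = (commutator x y + commutator x z) f"
    proof (cases "f \<in> KG")
      case True
      then show ?thesis using dd[OF x] dd(3)[OF y] dd(3)[OF z] by (simp add: commutator_def)
    next
      case False
      then have 0: "x f = 0" "y f = 0" "z f = 0" using off x y z by auto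
      have "commutator x (y + z) f = x (0 + 0) - (y 0 + z 0)" by (simp only: commutator_def 0 plus_fun_apply)
      then show ?thesis by (simp add: commutator_def 0 zero[OF x] zero[OF y] zero[OF z] fun_eq_iff)
    qed
  qed
  show "commutator x (commutator y z) + commutator y (commutator z x)
      + commutator z (commutator x y) = 0"
  proof
    fix f show "(commutator x (commutator y z) + commutator y (commutator z x)
      + commutator z (commutator x y)) f = 0 f"
    proof (cases "f \<in> KG")
      case True
      have in_KG: "D f \<in> KG" "D (E f) \<in> KG" if "D \<in> lie G" "E \<in> lie G" for D E
        using dd(3)[OF that(1)] dd(3)[OF that(2) True True] True by auto
      have expand: "commutator a (commutator b c) f = a (b (c f)) - a (c (b f)) - (b (c (a f)) - c (b (a f)))"
        if "a \<in> lie G" "b \<in> lie G" "c \<in> lie G" for a b c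
        unfolding commutator_def
        using minus[OF that(1) in_KG(2)[OF that(2,3)] in_KG(2)[OF that(3,2)]] by simp
      show ?thesis
        unfolding plus_fun_apply expand[OF x y z] expand[OF y z x] expand[OF z x y]
        by (simp add: fun_eq_iff)
    next
      case False
      then have 0: "x f = 0" "y f = 0" "z f = 0" using off x y z by auto
      show ?thesis by (simp add: commutator_def 0 zero[OF x] zero[OF y] zero[OF z] fun_eq_iff)
    qed
  qed
qed

end

end

theory Submission
  imports Defs
begin

text \<open>
  Let \<open>dim \<qq> = 2 n + 1\<close>. If \<open>(d\<alpha>)\<^sup>n \<noteq> 0\<close> and \<open>x\<close> is in the stabiliser of \<open>\<alpha>\<close>, then
  contracting with \<open>x\<close> shows that \<open>\<alpha> x \<noteq> 0\<close> implies \<open>(d\<alpha>)\<^sup>n \<and> \<alpha> \<noteq> 0\<close>. The first condition on \<open>\<alpha>\<close> is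
  Zariski open, and non-empty since the index is 1. If \<open>F\<close> is an invariant, its differential at
  \<open>\<alpha>\<close>, regarded as an element \<open>x\<close> of \<open>\<qq>\<close>, lies in the stabiliser of \<open>\<alpha>\<close>, and \<open>\<alpha> x\<close> is the radial
  derivative of \<open>F\<close> at \<open>\<alpha>\<close>, which is not identically 0 because \<open>F\<close> is not constant.
\<close>

section \<open>Signed sums over permutations and exterior powers of a 2-form\<close>

definition alternation :: "nat \<Rightarrow> ((nat \<Rightarrow> 'v) \<Rightarrow> 'k::comm_ring_1) \<Rightarrow> (nat \<Rightarrow> 'v) \<Rightarrow> 'k" where
  "alternation p \<phi> v = (\<Sum>\<tau> | \<tau> permutes {..<p}. of_int (sign \<tau>) * \<phi> (v \<circ> \<tau>))"

text \<open>For alternating \<open>B\<close>, \<open>alternation (2 * n) (pairing n B) v\<close> is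
  \<open>2 ^ n * fact n\<close> times the Pfaffian of the matrix \<open>B (v i) (v j)\<close> with
  \<open>i, j < 2 * n\<close>; without normalisation it makes sense over any commutative
  ring.\<close>

definition pairing :: "nat \<Rightarrow> ('v \<Rightarrow> 'v \<Rightarrow> 'k::comm_ring_1) \<Rightarrow> (nat \<Rightarrow> 'v) \<Rightarrow> 'k" where
  "pairing n B v = (\<Prod>i<n. B (v (2 * i)) (v (Suc (2 * i))))"

lemma sign_compose_permutes:
  assumes "\<sigma> permutes {..<m::nat}" "\<tau> permutes {..<m}"
  shows "sign (\<sigma> \<circ> \<tau>) = sign \<sigma> * sign \<tau>"
  using assms by (intro sign_compose) (auto simp: permutation_permutes)

text \<open>Composing with a permutation \<tau> of the first \<open>p\<close> indices permutes the
  outer sum and multiplies the signs, so each of the \<open>fact p\<close> inner terms yields the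
  same outer sum. This cancels the \<open>fact p\<close> in \<open>wedge\<close>.\<close>

lemma wedge_alternation:
  "wedge p q (\<lambda>v. c * alternation p \<phi> v) \<eta> v
     = c * inverse (fact q) * alternation (p + q) (\<lambda>v. \<phi> v * \<eta> (\<lambda>i. v (p + i))) v"
proof -
  let ?S = "\<lambda>m. {\<sigma>. \<sigma> permutes {..<m::nat}}"
  define t where "t \<sigma> = of_int (sign \<sigma>) * (\<phi> (v \<circ> \<sigma>) * \<eta> (\<lambda>i. v (\<sigma> (p + i))))" for \<sigma>
  have t: "of_int (sign \<sigma>) * (of_int (sign \<tau>) * \<phi> ((\<lambda>i. v (\<sigma> i)) \<circ> \<tau>)) * \<eta> (\<lambda>i. v (\<sigma> (p + i))) = t (\<sigma> \<circ> \<tau>)"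
    if "\<sigma> \<in> ?S (p + q)" "\<tau> \<in> ?S p" for \<sigma> \<tau>
  proof -
    have "\<tau> permutes {..<p + q}" using that(2) by (auto intro: permutes_subset)
    then have "sign (\<sigma> \<circ> \<tau>) = sign \<sigma> * sign \<tau>" using that(1) by (simp add: sign_compose_permutes)
    moreover have "\<tau> (p + i) = p + i" for i using that(2) by (auto simp: permutes_def)
    ultimately show ?thesis by (simp add: t_def comp_def mult.assoc)
  qed
  have "(\<Sum>\<sigma>\<in>?S (p + q). of_int (sign \<sigma>) * (c * alternation p \<phi> (\<lambda>i. v (\<sigma> i))) * \<eta> (\<lambda>i. v (\<sigma> (p + i))))
      = (\<Sum>\<sigma>\<in>?S (p + q). \<Sum>\<tau>\<in>?S p. c * t (\<sigma> \<circ> \<tau>))"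
    by (intro sum.cong refl)
      (simp add: alternation_def sum_distrib_left sum_distrib_right t[symmetric] mult_ac)
  also have "\<dots> = (\<Sum>\<tau>\<in>?S p. \<Sum>\<sigma>\<in>?S (p + q). c * t (\<sigma> \<circ> \<tau>))" by (rule sum.swap)
  also have "\<dots> = (\<Sum>\<tau>\<in>?S p. c * sum t (?S (p + q)))"
  proof (intro sum.cong refl)
    fix \<tau> assume "\<tau> \<in> ?S p"
    then have "\<tau> permutes {..<p + q}" by (auto intro: permutes_subset)
    then show "(\<Sum>\<sigma>\<in>?S (p + q). c * t (\<sigma> \<circ> \<tau>)) = c * sum t (?S (p + q))"
      using sum_permutations_compose_right[of \<tau> "{..<p + q}" t] by (simp add: sum_distrib_left)
  qed
  also have "\<dots> = fact p * (c * sum t (?S (p + q)))"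
    by (simp add: card_permutations[of "{..<p}" p])
  finally show ?thesis
    unfolding wedge_def by (simp add: alternation_def t_def comp_def mult_ac)
qed

text \<open>Each new factor enters through \<open>wedge_alternation\<close> with
  \<open>q = 2\<close> and contributes \<open>inverse (fact 2)\<close>.\<close>

lemma wedge_power_pairing:
  fixes B :: "'v \<Rightarrow> 'v \<Rightarrow> 'k::field_char_0"
  shows "wedge_power 2 (\<lambda>v. B (v 0) (v 1)) n
    = (\<lambda>v. inverse (2 ^ n) * alternation (2 * n) (pairing n B) v)"
proof (induction n)
  case 0
  show ?case by (simp add: alternation_def pairing_def)
next
  case (Suc n)
  have "pairing (Suc n) B = (\<lambda>v. pairing n B v * B (v (n * 2 + 0)) (v (n * 2 + 1)))"
    by (simp add: pairing_def fun_eq_iff mult.commute)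
  then show ?case
    unfolding wedge_power.simps Suc by (simp add: fun_eq_iff mult.commute[of 2 n] wedge_alternation)
qed

text \<open>A permutation that moves \<open>2 * n\<close> puts the radical vector
  \<open>w (2 * n)\<close> into some pair, which kills the product. The others permute only the
  first \<open>2 * n\<close> indices and leave the argument of \<alpha> fixed.\<close>

lemma alternation_Suc_radical:
  assumes x: "\<And>i. B (w i) (w (2 * n)) = 0" "\<And>i. B (w (2 * n)) (w i) = 0"
  shows "alternation (2 * n + 1) (\<lambda>v. pairing n B v * \<alpha> (v (2 * n))) w
    = alternation (2 * n) (pairing n B) w * \<alpha> (w (2 * n))"
proof -
  let ?S = "\<lambda>m. {\<sigma>. \<sigma> permutes {..<m::nat}}"
  have "of_int (sign \<sigma>) * (pairing n B (w \<circ> \<sigma>) * \<alpha> ((w \<circ> \<sigma>) (2 * n))) = 0"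
    if \<sigma>: "\<sigma> \<in> ?S (2 * n + 1) - ?S (2 * n)" for \<sigma>
  proof -
    have p: "\<sigma> permutes {..<2 * n + 1}" using \<sigma> by simp
    have "\<sigma> (2 * n) \<noteq> 2 * n"
    proof
      assume "\<sigma> (2 * n) = 2 * n"
      then have "\<sigma> permutes {..<2 * n}"
        using p by (intro permutes_superset[OF p]) (auto simp: less_Suc_eq)
      then show False using \<sigma> by simp
    qed
    moreover obtain j where j: "\<sigma> j = 2 * n" using permutes_surj[OF p] by (metis surj_def)
    ultimately have "j < 2 * n" using permutes_in_image[OF p, of j] by (cases "j = 2 * n") auto
    then obtain i where i: "i < n" "j = 2 * i \<or> j = Suc (2 * i)"
      by (metis evenE oddE Suc_eq_plus1 mult_less_cancel1 Suc_lessD)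
    have "B ((w \<circ> \<sigma>) (2 * i)) ((w \<circ> \<sigma>) (Suc (2 * i))) = 0"
      using i(2) j x by auto
    then have "pairing n B (w \<circ> \<sigma>) = 0"
      unfolding pairing_def using i(1) by (intro prod_zero) auto
    then show ?thesis by simp
  qed
  moreover have "\<alpha> (w (\<sigma> (2 * n))) = \<alpha> (w (2 * n))" if "\<sigma> permutes {..<2 * n}" for \<sigma>
    using permutes_not_in[OF that, of "2 * n"] by simp
  moreover have "?S (2 * n) \<subseteq> ?S (2 * n + 1)" by (auto intro: permutes_subset)
  ultimately have "alternation (2 * n + 1) (\<lambda>v. pairing n B v * \<alpha> (v (2 * n))) w
      = (\<Sum>\<sigma>\<in>?S (2 * n). of_int (sign \<sigma>) * pairing n B (w \<circ> \<sigma>) * \<alpha> (w (2 * n)))"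
    unfolding alternation_def
    by (intro sum.mono_neutral_cong_right) (auto simp: finite_permutations mult.assoc)
  then show ?thesis by (simp add: alternation_def sum_distrib_right)
qed

text \<open>This is the expansion of a Pfaffian along the row of \<open>w (2 * n)\<close>, where
  only the entry at \<open>Suc (2 * n)\<close> can be non-zero. The factor \<open>2 * Suc n\<close>
  counts the positions that the index \<open>2 * n\<close> can take in the product; by symmetry they
  contribute equally.\<close>

lemma alternation_hyperbolic:
  fixes B :: "'v \<Rightarrow> 'v \<Rightarrow> 'k::comm_ring_1"
  assumes anti: "\<And>i j. B (w i) (w j) = - B (w j) (w i)"
    and orth: "\<And>j. j \<le> 2 * n \<Longrightarrow> B (w (2 * n)) (w j) = 0"
  shows "alternation (2 * Suc n) (pairing (Suc n) B) w
    = of_nat (2 * Suc n) * B (w (2 * n)) (w (Suc (2 * n))) * alternation (2 * n) (pairing n B) w"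
proof -
  let ?I = "{..<2 * Suc n}"
  let ?S = "{\<sigma>. \<sigma> permutes ?I}"
  define T where "T \<sigma> = of_int (sign \<sigma>) * pairing (Suc n) B (w \<circ> \<sigma>)" for \<sigma>
  \<comment> \<open>The sum is split by the position \<open>j\<close> at which
    \<open>w (2 * n)\<close> stands.\<close>
  define A where "A j = (\<Sum>\<sigma>\<in>?S. if \<sigma> j = 2 * n then T \<sigma> else 0)" for j
  have A_cong: "A (\<pi> j) = A j"
    if \<pi>: "\<pi> permutes ?I" and inv: "\<And>\<sigma>. \<sigma> permutes ?I \<Longrightarrow> T (\<sigma> \<circ> \<pi>) = T \<sigma>" for \<pi> j
  proof -
    have "A j = (\<Sum>\<sigma>\<in>?S. if (\<sigma> \<circ> \<pi>) j = 2 * n then T (\<sigma> \<circ> \<pi>) else 0)"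
      unfolding A_def by (rule sum_permutations_compose_right[OF \<pi>])
    also have "\<dots> = A (\<pi> j)" unfolding A_def using inv by (intro sum.cong) auto
    finally show ?thesis by simp
  qed
  have sgn: "of_int (sign (\<sigma> \<circ> Transposition.transpose a b)) = (- of_int (sign \<sigma>) :: 'k)"
    if "\<sigma> permutes ?I" "a \<in> ?I" "b \<in> ?I" "a \<noteq> b" for \<sigma> a b
    using that by (simp add: sign_compose_permutes[OF _ permutes_swap_id] sign_swap_id)
  \<comment> \<open>Exchanging the two entries of pair \<open>i\<close> changes the sign of the
    permutation and, by antisymmetry, the sign of one factor.\<close>
  have odd: "A (Suc (2 * i)) = A (2 * i)" if i: "i \<le> n" for i
  proof -
    let ?\<pi> = "Transposition.transpose (2 * i) (Suc (2 * i))"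
    have \<pi>: "?\<pi> permutes ?I" using i by (intro permutes_swap_id) auto
    have "T (\<sigma> \<circ> ?\<pi>) = T \<sigma>" if \<sigma>: "\<sigma> permutes ?I" for \<sigma>
    proof -
      have fixed: "?\<pi> (2 * k) = 2 * k" "?\<pi> (Suc (2 * k)) = Suc (2 * k)" if "k \<noteq> i" for k
        using that by (auto simp: Transposition.transpose_def)
      have iI: "i \<in> {..<Suc n}" using i by auto
      have "pairing (Suc n) B (w \<circ> (\<sigma> \<circ> ?\<pi>)) = - pairing (Suc n) B (w \<circ> \<sigma>)"
        unfolding pairing_def prod.remove[OF finite_lessThan iI]
        using anti[of "\<sigma> (Suc (2 * i))" "\<sigma> (2 * i)"] fixed by simp
      then show ?thesis unfolding T_def using i by (subst sgn[OF \<sigma>]) auto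
    qed
    from A_cong[OF \<pi> this, of "2 * i"] show ?thesis by simp
  qed
  \<comment> \<open>Exchanging pair \<open>i\<close> with pair \<open>n\<close> takes two
    transpositions, so the sign is kept, and it only reorders the factors.\<close>
  have even: "A (2 * i) = A (2 * n)" if i: "i < n" for i
  proof -
    let ?a = "Transposition.transpose (2 * i) (2 * n)" and ?b = "Transposition.transpose (Suc (2 * i)) (Suc (2 * n))"
    have ab: "?a permutes ?I" "?b permutes ?I" using i by (auto intro: permutes_swap_id)
    have "T (\<sigma> \<circ> (?a \<circ> ?b)) = T \<sigma>" if \<sigma>: "\<sigma> permutes ?I" for \<sigma>
    proof -
      have "(?a \<circ> ?b) (2 * k) = 2 * Transposition.transpose i n k"
        "(?a \<circ> ?b) (Suc (2 * k)) = Suc (2 * Transposition.transpose i n k)" for k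
        by (auto simp: Transposition.transpose_def)
      then have "pairing (Suc n) B (w \<circ> (\<sigma> \<circ> (?a \<circ> ?b)))
          = (\<Prod>k<Suc n. (\<lambda>k. B (w (\<sigma> (2 * k))) (w (\<sigma> (Suc (2 * k))))) (Transposition.transpose i n k))"
        unfolding pairing_def by simp
      also have "\<dots> = pairing (Suc n) B (w \<circ> \<sigma>)"
        unfolding pairing_def comp_def using i
        by (intro prod.permute[symmetric, unfolded comp_def] permutes_swap_id) auto
      finally show ?thesis
        unfolding T_def using i
        by (simp add: comp_assoc[symmetric] sgn[OF \<sigma>] sgn[OF permutes_compose[OF ab(1) \<sigma>]])
    qed
    from A_cong[OF permutes_compose[OF ab(2,1)] this, of "2 * i"] i show ?thesis
      by (simp add: Transposition.transpose_def)
  qed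
  have A_eq: "A j = A (2 * n)" if "j \<in> ?I" for j
  proof -
    have "j div 2 \<le> n" "j = 2 * (j div 2) \<or> j = Suc (2 * (j div 2))" using that by auto
    then obtain i where "i \<le> n" "j = 2 * i \<or> j = Suc (2 * i)" by blast
    then show ?thesis using odd even by (cases "i = n") auto
  qed
  \<comment> \<open>Exactly one position is sent to \<open>2 * n\<close>, so the inner sum returns
    \<open>T \<sigma>\<close>.\<close>
  have "sum T ?S = (\<Sum>\<sigma>\<in>?S. \<Sum>j\<in>?I. if \<sigma> j = 2 * n then T \<sigma> else 0)"
  proof (intro sum.cong refl)
    fix \<sigma> assume "\<sigma> \<in> ?S"
    then have p: "\<sigma> permutes ?I" by simp
    have "\<sigma> j = 2 * n \<longleftrightarrow> j = inv_into UNIV \<sigma> (2 * n)" for j using permutes_inv_eq[OF p] by metis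
    moreover have "inv_into UNIV \<sigma> (2 * n) \<in> ?I" using permutes_in_image[OF permutes_inv[OF p]] by auto
    ultimately show "T \<sigma> = (\<Sum>j\<in>?I. if \<sigma> j = 2 * n then T \<sigma> else 0)" by simp
  qed
  also have "\<dots> = sum A ?I" unfolding A_def by (rule sum.swap)
  also have "\<dots> = (\<Sum>j\<in>?I. A (2 * n))" by (rule sum.cong[OF refl A_eq])
  also have "\<dots> = of_nat (2 * Suc n) * A (2 * n)" by simp
  \<comment> \<open>If \<sigma> fixes \<open>2 * n\<close> but moves \<open>Suc (2 * n)\<close>,
    then the partner of \<open>w (2 * n)\<close> has index at most \<open>2 * n\<close> and
    \<open>orth\<close> gives 0. If it fixes both, it permutes the first \<open>2 * n\<close>
    indices.\<close>
  also have "A (2 * n) = (\<Sum>\<sigma> | \<sigma> permutes {..<2 * n}.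
      B (w (2 * n)) (w (Suc (2 * n))) * (of_int (sign \<sigma>) * pairing n B (w \<circ> \<sigma>)))"
    unfolding A_def
  proof (intro sum.mono_neutral_cong_right ballI)
    show "{\<sigma>. \<sigma> permutes {..<2 * n}} \<subseteq> ?S" by (auto intro: permutes_subset)
    fix \<sigma> assume "\<sigma> \<in> ?S - {\<sigma>. \<sigma> permutes {..<2 * n}}"
    then have p: "\<sigma> permutes ?I" and np: "\<not> \<sigma> permutes {..<2 * n}" by auto
    show "(if \<sigma> (2 * n) = 2 * n then T \<sigma> else 0) = 0"
    proof (cases "\<sigma> (2 * n) = 2 * n")
      case True
      have "\<sigma> (Suc (2 * n)) \<noteq> Suc (2 * n)"
      proof
        assume fixed: "\<sigma> (Suc (2 * n)) = Suc (2 * n)"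
        have "\<sigma> j = j" if "j \<in> ?I - {..<2 * n}" for j
        proof -
          have "2 * n \<le> j" "j < 2 * Suc n" using that by simp_all
          then have "j = 2 * n \<or> j = Suc (2 * n)" by arith
          then consider "j = 2 * n" | "j = Suc (2 * n)" by blast
          then show ?thesis using True fixed by cases (simp_all only:)
        qed
        then have "\<sigma> permutes {..<2 * n}" by (rule permutes_superset[OF p])
        then show False using np by contradiction
      qed
      moreover have "\<sigma> (Suc (2 * n)) < 2 * Suc n" using permutes_in_image[OF p, of "Suc (2 * n)"] by simp
      ultimately have "B (w (2 * n)) (w (\<sigma> (Suc (2 * n)))) = 0" by (intro orth) simp
      then show ?thesis using True by (simp add: T_def pairing_def)
    qed simp
  next
    fix \<sigma> assume "\<sigma> \<in> {\<sigma>. \<sigma> permutes {..<2 * n}}"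
    then have "\<sigma> (2 * n) = 2 * n" "\<sigma> (Suc (2 * n)) = Suc (2 * n)" by (auto simp: permutes_def)
    then show "(if \<sigma> (2 * n) = 2 * n then T \<sigma> else 0)
        = B (w (2 * n)) (w (Suc (2 * n))) * (of_int (sign \<sigma>) * pairing n B (w \<circ> \<sigma>))"
      by (simp add: T_def pairing_def)
  qed (simp add: finite_permutations)
  finally show ?thesis
    by (simp add: T_def alternation_def sum_distrib_left mult.assoc)
qed

lemma alternation_pairing_cong:
  assumes "\<And>i. i < 2 * n \<Longrightarrow> v i = w i"
  shows "alternation (2 * n) (pairing n B) v = alternation (2 * n) (pairing n B) w"
  unfolding alternation_def
proof (intro sum.cong refl arg_cong2[where f = "(*)"])
  fix \<sigma> assume "\<sigma> \<in> {\<sigma>. \<sigma> permutes {..<2 * n}}"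
  then have "i < 2 * n \<Longrightarrow> \<sigma> i < 2 * n" for i using permutes_in_image[of \<sigma> "{..<2 * n}" i] by simp
  then show "pairing n B (v \<circ> \<sigma>) = pairing n B (w \<circ> \<sigma>)"
    unfolding pairing_def using assms by (intro prod.cong) auto
qed

section \<open>Rank and radical of an alternating bilinear form\<close>

locale vector_space_char_0 = vector_space scale
  for scale :: "'k::field_char_0 \<Rightarrow> 'v::ab_group_add \<Rightarrow> 'v"
begin

text \<open>The conditions are relative to \<open>L\<close> because a Lie bracket is only known to
  be bilinear on its carrier.\<close>

definition alternating_on :: "'v set \<Rightarrow> ('v \<Rightarrow> 'v \<Rightarrow> 'k) \<Rightarrow> bool" where
  "alternating_on L B \<longleftrightarrow> (\<forall>x\<in>L. B x x = 0) \<and>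
     (\<forall>x\<in>L. \<forall>y\<in>L. \<forall>z\<in>L. B (x + y) z = B x z + B y z \<and> B x (y + z) = B x y + B x z) \<and>
     (\<forall>c. \<forall>x\<in>L. \<forall>y\<in>L. B (scale c x) y = c * B x y \<and> B x (scale c y) = c * B x y)"

lemma alternating_on_antisym:
  assumes "subspace L" "alternating_on L B" "x \<in> L" "y \<in> L"
  shows "B x y = - B y x"
proof -
  have add: "B (x + y) z = B x z + B y z" "B z (x + y) = B z x + B z y" and diag: "B z z = 0"
    if "x \<in> L" "y \<in> L" "z \<in> L" for x y z
    using assms(2) that by (auto simp: alternating_on_def)
  have "x + y \<in> L" using assms by (simp add: subspace_add)
  then have "0 = B (x + y) (x + y)" using assms diag by simp
  also have "\<dots> = (B x x + B x y) + (B y x + B y y)"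
    using assms \<open>x + y \<in> L\<close> by (simp only: add(1)) (simp only: add(2))
  finally show ?thesis using assms by (simp add: diag eq_neg_iff_add_eq_0)
qed

text \<open>Splitting off hyperbolic planes; the alternation is a multiple of the Pfaffian of \<open>B\<close> modulo
  its radical.\<close>

lemma dim_eq_rank_plus_radical:
  assumes "subspace L" "L \<subseteq> span A" "finite A" "alternating_on L B"
  shows "\<exists>n v. dim L = 2 * n + dim {x \<in> L. \<forall>y\<in>L. B x y = 0} \<and> (\<forall>i. v i \<in> L) \<and>
    alternation (2 * n) (pairing n B) v \<noteq> 0"
  using assms(1,2,4)
proof (induction "dim L" arbitrary: L rule: less_induct)
  case less
  note L = less.prems(1) and alt = less.prems(3)
  have add: "B (x + y) z = B x z + B y z" "B z (x + y) = B z x + B z y"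
    and scl: "B (scale c x) y = c * B x y" "B y (scale c x) = c * B y x" and diag: "B x x = 0"
    if "x \<in> L" "y \<in> L" "z \<in> L" for x y z c
    using alt that by (auto simp: alternating_on_def)
  note anti = alternating_on_antisym[OF L alt]
  show ?case
  proof (cases "\<forall>x\<in>L. \<forall>y\<in>L. B x y = 0")
    case True
    then have "{x \<in> L. \<forall>y\<in>L. B x y = 0} = L" by auto
    \<comment> \<open>For the zero form the radical is everything, and the empty product has
      alternation 1.\<close>
    then show ?thesis using L subspace_0
      by (intro exI[of _ 0] exI[of _ "\<lambda>_. 0"]) (auto simp: alternation_def pairing_def)
  next
    case False
    then obtain e f0 where e: "e \<in> L" and f0: "f0 \<in> L" "B e f0 \<noteq> 0" by auto
    \<comment> \<open>Rescaling makes \<open>e, f\<close> a hyperbolic pair.\<close>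
    define f where "f = scale (inverse (B e f0)) f0"
    have f: "f \<in> L" and ef: "B e f = 1"
      using e f0 by (auto simp: f_def subspace_scale L scl)
    have fe: "B f e = -1" using anti[OF f e] ef by simp
    \<comment> \<open>The orthogonal complement of the hyperbolic plane, to which the induction
      hypothesis is applied.\<close>
    define L' where "L' = {x \<in> L. B e x = 0 \<and> B f x = 0}"
    have sub: "L' \<subseteq> L" by (auto simp: L'_def)
    have L': "subspace L'"
    proof -
      have "B e 0 = 0" "B f 0 = 0" using scl(2)[of e e e 0] scl(2)[of f f f 0] e f by auto
      then show ?thesis
        using L e f by (auto simp: L'_def subspace_def add scl)
    qed
    have alt': "alternating_on L' B" using alt sub unfolding alternating_on_def by blast
    \<comment> \<open>This is the projection to \<open>L'\<close> along the plane of
      \<open>e\<close> and \<open>f\<close>; the signs come from \<open>B e f = 1\<close> and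
      \<open>B f e = -1\<close>.\<close>
    have decomp: "x - scale (B e x) f + scale (B f x) e \<in> L'" if x: "x \<in> L" for x
    proof -
      have eq: "x - scale (B e x) f + scale (B f x) e = x + scale (- B e x) f + scale (B f x) e"
        by simp
      moreover have "scale c e \<in> L" "scale c f \<in> L" "x + scale c f \<in> L"
        "x + scale c f + scale d e \<in> L" for c d
        using e f x L by (auto intro: subspace_add subspace_scale)
      ultimately show ?thesis
        using x e f unfolding eq by (simp add: L'_def add scl diag ef fe del: scale_minus_left)
    qed
    obtain C where C: "C \<subseteq> L'" "independent C" "L' \<subseteq> span C" "card C = dim L'"
      by (rule basis_exists)
    have spC: "span C = L'" using C(1,3) span_minimal[OF C(1) L'] by auto
    have finC: "finite C" using independent_span_bound[OF assms(3) C(2)] C(1) sub less.prems(2) by auto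
    have f_out: "f \<notin> span C" using ef by (auto simp: spC L'_def)
    \<comment> \<open>Applying \<open>B f\<close> to an element \<open>e - scale k f\<close> of
      \<open>L'\<close> would give both 0 and -1.\<close>
    have e_out: "e \<notin> span (insert f C)"
    proof
      assume "e \<in> span (insert f C)"
      then obtain k where "e - scale k f \<in> L'" by (auto simp: span_breakdown_eq spC)
      then have "B f (e + scale (- k) f) = 0" by (simp add: L'_def)
      then show False
        using e f L by (simp add: add scl diag fe subspace_scale del: scale_minus_left)
    qed
    have ind: "independent (insert e (insert f C))"
      using e_out f_out C(2) by (intro independent_insertI) 
    have "span (insert e (insert f C)) = span L"
    proof
      show "span (insert e (insert f C)) \<subseteq> span L" using C(1) sub e f by (intro span_mono) auto
      have "x \<in> span (insert e (insert f C))" if "x \<in> L" for x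
        using decomp[OF that] unfolding span_breakdown_eq spC
        by (intro exI[of _ "- B f x"] exI[of _ "B e x"]) (simp add: algebra_simps)
      then show "span L \<subseteq> span (insert e (insert f C))" by (intro span_minimal) auto
    qed
    from dim_eq_card[OF this ind] have dimL: "dim L = dim L' + 2"
      using finC e_out f_out C(4) span_superset[of "insert f C"] span_superset[of C]
      by (auto simp: card_insert_if)
    \<comment> \<open>\<open>L\<close> is the sum of \<open>L'\<close> and the plane, and these are
      orthogonal, so testing against \<open>L'\<close> suffices for an element of
      \<open>L'\<close>.\<close>
    have rad: "{x \<in> L'. \<forall>y\<in>L'. B x y = 0} = {x \<in> L. \<forall>y\<in>L. B x y = 0}"
    proof (intro Set.set_eqI iffI)
      fix x assume "x \<in> {x \<in> L. \<forall>y\<in>L. B x y = 0}"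
      then show "x \<in> {x \<in> L'. \<forall>y\<in>L'. B x y = 0}"
        using anti[of e x] anti[of f x] e f sub by (auto simp: L'_def)
    next
      fix x assume "x \<in> {x \<in> L'. \<forall>y\<in>L'. B x y = 0}"
      then have x: "x \<in> L'" "x \<in> L" "\<And>y. y \<in> L' \<Longrightarrow> B x y = 0" using sub by auto
      have "B x y = 0" if y: "y \<in> L" for y
      proof -
        define z where "z = y - scale (B e y) f + scale (B f y) e"
        have z: "z \<in> L'" "z \<in> L" using decomp[OF y] sub by (auto simp: z_def)
        have y_eq: "y = z + (scale (B e y) f + scale (- B f y) e)" by (simp add: z_def)
        have "B x e = 0" "B x f = 0" using x(1) anti[OF x(2) e] anti[OF x(2) f] by (auto simp: L'_def)
        moreover have "scale c e \<in> L" "scale c f \<in> L" "scale c f + scale d e \<in> L" for c d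
          using e f L by (auto intro: subspace_add subspace_scale)
        ultimately show ?thesis
          using x z e f by (subst y_eq) (simp add: add scl del: scale_minus_left)
      qed
      then show "x \<in> {x \<in> L. \<forall>y\<in>L. B x y = 0}" using x by auto
    qed
    obtain n v where nv: "dim L' = 2 * n + dim {x \<in> L. \<forall>y\<in>L. B x y = 0}" "\<And>i. v i \<in> L'"
      "alternation (2 * n) (pairing n B) v \<noteq> 0"
      using less.hyps[OF _ L' _ alt'] dimL sub less.prems(2) unfolding rad by auto
    \<comment> \<open>The new pair takes the positions \<open>2 * n\<close> and
      \<open>Suc (2 * n)\<close>, after the vectors of \<open>L'\<close>, all of which are
      orthogonal to \<open>e\<close>.\<close>
    define w where "w = v(2 * n := e, Suc (2 * n) := f)"
    have w: "w i \<in> L" for i using nv(2)[of i] sub e f by (auto simp: w_def)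
    have "B (w (2 * n)) (w j) = 0" if "j \<le> 2 * n" for j
      using that nv(2)[of j] diag[OF e e e] by (simp add: w_def L'_def)
    then have "alternation (2 * Suc n) (pairing (Suc n) B) w
        = of_nat (2 * Suc n) * B (w (2 * n)) (w (Suc (2 * n))) * alternation (2 * n) (pairing n B) w"
      by (intro alternation_hyperbolic anti w)
    moreover have "alternation (2 * n) (pairing n B) w = alternation (2 * n) (pairing n B) v"
      by (intro alternation_pairing_cong) (auto simp: w_def)
    moreover have "B (w (2 * n)) (w (Suc (2 * n))) = 1" by (simp add: w_def ef)
    ultimately have "alternation (2 * Suc n) (pairing (Suc n) B) w \<noteq> 0"
      using nv(3) by (simp del: of_nat_Suc of_nat_mult mult_Suc_right)
    then show ?thesis
      using dimL nv(1) w by (intro exI[of _ "Suc n"] exI[of _ w]) auto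
  qed
qed

end

section \<open>Polynomial dependence on a parameter\<close>

lemma ex_poly_sum:
  fixes f :: "'i \<Rightarrow> 'k::comm_ring_1 \<Rightarrow> 'k"
  assumes "\<And>i. i \<in> I \<Longrightarrow> \<exists>p. \<forall>t. f i t = poly p t"
  shows "\<exists>p. \<forall>t. (\<Sum>i\<in>I. f i t) = poly p t"
proof -
  obtain p where "\<And>i t. i \<in> I \<Longrightarrow> f i t = poly (p i) t" using assms by metis
  then show ?thesis by (intro exI[of _ "sum p I"]) (simp add: poly_sum)
qed

text \<open>Along a line of forms every factor of the product is a polynomial of degree at most 1 in
  \<open>t\<close>.\<close>

lemma ex_poly_alternation_pairing:
  "\<exists>p. \<forall>t. alternation (2 * n) (pairing n (\<lambda>x y. B x y + t * C x y)) v = poly p t"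
  unfolding alternation_def
proof (intro ex_poly_sum)
  fix \<sigma> :: "nat \<Rightarrow> nat"
  show "\<exists>p. \<forall>t. of_int (sign \<sigma>) * pairing n (\<lambda>x y. B x y + t * C x y) (v \<circ> \<sigma>) = poly p t"
    by (intro exI[of _ "smult (of_int (sign \<sigma>)) (\<Prod>i<n. [:B (v (\<sigma> (2 * i))) (v (\<sigma> (Suc (2 * i)))),
        C (v (\<sigma> (2 * i))) (v (\<sigma> (Suc (2 * i)))):])"])
      (simp add: pairing_def poly_prod)
qed

lemma alternation_pairing_scale:
  "alternation (2 * n) (pairing n (\<lambda>x y. c * B x y)) v = c ^ n * alternation (2 * n) (pairing n B) v"
  by (simp add: alternation_def pairing_def prod.distrib sum_distrib_left mult_ac)

text \<open>A non-zero polynomial over an infinite domain has a non-root; this is applied to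
  \<open>p * q\<close>. It replaces the statement that two non-empty Zariski open sets meet.\<close>

lemma ex_common_nonroot:
  fixes p q :: "'k::{idom,ring_char_0} poly"
  assumes "p \<noteq> 0" "q \<noteq> 0"
  shows "\<exists>t. poly p t \<noteq> 0 \<and> poly q t \<noteq> 0"
proof -
  have "p * q \<noteq> 0" using assms by simp
  then show ?thesis using poly_all_0_iff_0[of "p * q"] by auto
qed

section \<open>Linear forms, the symmetric algebra and its differentials\<close>

context fin_dim_lie_algebra
begin

lemma dual_line: "\<gamma> \<in> dual \<Longrightarrow> \<delta> \<in> dual \<Longrightarrow> \<gamma> + fun_scale t \<delta> \<in> dual"
  by (auto simp: dual_def fun_scale_def algebra_simps)

lemma dual_scale: "\<gamma> \<in> dual \<Longrightarrow> fun_scale t \<gamma> \<in> dual"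
  by (auto simp: dual_def fun_scale_def algebra_simps)

lemma dual_zero: "0 \<in> dual"
  by (auto simp: dual_def)

lemma br_0_right: "x \<in> L \<Longrightarrow> br x 0 = 0"
  using br_scale_right[of x x 0] by simp

lemma br_antisym:
  assumes "x \<in> L" "y \<in> L"
  shows "br x y = - br y x"
proof -
  have "x + y \<in> L" using assms subspace_add[OF subspace_L] by simp
  then have "0 = br (x + y) (x + y)" using br_alternating by simp
  also have "\<dots> = (br x x + br x y) + (br y x + br y y)"
    using assms \<open>x + y \<in> L\<close> by (simp only: br_add_left) (simp only: br_add_right)
  finally show ?thesis using assms by (simp add: br_alternating eq_neg_iff_add_eq_0)
qed

lemma dual_minus:
  assumes "\<gamma> \<in> dual" "x \<in> L"
  shows "\<gamma> (- x) = - \<gamma> x"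
proof -
  have "\<gamma> (scale (- 1) x) = - 1 * \<gamma> x" using assms unfolding dual_def by blast
  then show ?thesis by simp
qed

lemma sym_act:
  assumes "\<xi> \<in> L"
  shows "sym_act \<xi> \<in> derivations sym_alg" "\<eta> \<in> L \<Longrightarrow> sym_act \<xi> (ev \<eta>) = ev (br \<xi> \<eta>)"
  using theI'[OF sym_act_ex1[OF assms]] unfolding sym_act_def by auto

text \<open>The generators are affine functions of \<open>t\<close> along a line, and polynomials
  are closed under sums and products.\<close>

lemma sym_alg_line_poly:
  assumes "F \<in> sym_alg" "\<gamma> \<in> dual" "\<delta> \<in> dual"
  shows "\<exists>p. \<forall>t. F (\<gamma> + fun_scale t \<delta>) = poly p t"
  using assms(1) unfolding sym_alg_def
proof (induction rule: fun_alg.induct)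
  case (const c)
  show ?case using dual_line[OF assms(2,3)]
    by (intro exI[of _ "[:c:]"]) (simp add: on_set_def del: plus_fun_apply)
next
  case (gen g)
  then obtain \<eta> where "g = ev \<eta>" by auto
  then show ?case using dual_line[OF assms(2,3)]
    by (intro exI[of _ "[:\<gamma> \<eta>, \<delta> \<eta>:]"])
      (simp add: on_set_ev ev_def on_set_def del: plus_fun_apply, simp add: fun_scale_def)
next
  case (add f g)
  then obtain p q where "\<forall>t. f (\<gamma> + fun_scale t \<delta>) = poly p t" "\<forall>t. g (\<gamma> + fun_scale t \<delta>) = poly q t"
    by blast
  then show ?case by (intro exI[of _ "p + q"] allI) (simp only: plus_fun_apply[of f g] poly_add)
next
  case (mult f g)
  then obtain p q where "\<forall>t. f (\<gamma> + fun_scale t \<delta>) = poly p t" "\<forall>t. g (\<gamma> + fun_scale t \<delta>) = poly q t"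
    by blast
  then show ?case by (intro exI[of _ "p * q"] allI) (simp only: times_fun_apply[of f g] poly_mult)
qed

text \<open>The element \<open>x\<close> is the differential of \<open>F\<close> at \<open>\<gamma>\<close>.\<close>

lemma ex_differential:
  assumes "F \<in> sym_alg" and \<gamma>: "\<gamma> \<in> dual"
  shows "\<exists>x\<in>L. (\<forall>\<xi>\<in>L. sym_act \<xi> F \<gamma> = \<gamma> (br \<xi> x)) \<and>
    (\<exists>p. (\<forall>t. F (fun_scale t \<gamma>) = poly p t) \<and> poly (pderiv p) 1 = \<gamma> x)"
proof -
  have lin: "\<gamma> (x + y) = \<gamma> x + \<gamma> y" "\<gamma> (scale c x) = c * \<gamma> x" if "x \<in> L" "y \<in> L" for x y c
    using \<gamma> that by (auto simp: dual_def)
  have \<gamma>0: "\<gamma> 0 = 0" using lin(2)[of 0 0 0] subspace_0[OF subspace_L] by simp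
  \<comment> \<open>The ray through \<gamma> reaches \<gamma> at \<open>t = 1\<close>, which is why
    the radial derivative is taken there.\<close>
  have one: "fun_scale 1 \<gamma> = \<gamma>" by (simp add: fun_scale_def)
  show ?thesis using assms(1) unfolding sym_alg_def
  proof (induction rule: fun_alg.induct)
    case (const c)
    have "sym_act \<xi> (on_set dual (\<lambda>_. c)) = 0" if "\<xi> \<in> L" for \<xi>
      using derivation_const sym_act(1)[OF that] unfolding sym_alg_def by blast
    then show ?case
      using dual_scale[OF \<gamma>] subspace_0[OF subspace_L]
      by (intro bexI[of _ 0] conjI exI[of _ "[:c:]"]) (auto simp: br_0_right \<gamma>0 on_set_def)
  next
    case (gen g)
    then obtain \<eta> where "g = ev \<eta>" "\<eta> \<in> L" by auto
    then show ?case using \<gamma> dual_scale[OF \<gamma>]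
      by (intro bexI[of _ \<eta>] conjI exI[of _ "[:0, \<gamma> \<eta>:]"])
        (auto simp: on_set_ev sym_act(2), auto simp: ev_def on_set_def fun_scale_def pderiv_pCons)
  next
    case (add f g)
    then obtain x p y q where xy: "x \<in> L" "y \<in> L" "\<And>\<xi>. \<xi> \<in> L \<Longrightarrow> sym_act \<xi> f \<gamma> = \<gamma> (br \<xi> x)"
      "\<And>\<xi>. \<xi> \<in> L \<Longrightarrow> sym_act \<xi> g \<gamma> = \<gamma> (br \<xi> y)"
      and pq: "\<And>t. f (fun_scale t \<gamma>) = poly p t" "poly (pderiv p) 1 = \<gamma> x"
        "\<And>t. g (fun_scale t \<gamma>) = poly q t" "poly (pderiv q) 1 = \<gamma> y" by blast
    have "sym_act \<xi> (f + g) \<gamma> = \<gamma> (br \<xi> (x + y))" if "\<xi> \<in> L" for \<xi>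
      using derivationsD(2)[OF sym_act(1)[OF that, unfolded sym_alg_def] add.hyps] xy that
      by (simp add: br_add_right lin br_closed)
    moreover have "(f + g) (fun_scale t \<gamma>) = poly (p + q) t" for t
      by (simp add: pq)
    moreover have "poly (pderiv (p + q)) 1 = \<gamma> (x + y)"
      by (simp add: pderiv_add pq lin xy)
    ultimately show ?case using subspace_add[OF subspace_L xy(1,2)] by blast
  next
    case (mult f g)
    then obtain x p y q where xy: "x \<in> L" "y \<in> L" "\<And>\<xi>. \<xi> \<in> L \<Longrightarrow> sym_act \<xi> f \<gamma> = \<gamma> (br \<xi> x)"
      "\<And>\<xi>. \<xi> \<in> L \<Longrightarrow> sym_act \<xi> g \<gamma> = \<gamma> (br \<xi> y)"
      and pq: "\<And>t. f (fun_scale t \<gamma>) = poly p t" "poly (pderiv p) 1 = \<gamma> x"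
        "\<And>t. g (fun_scale t \<gamma>) = poly q t" "poly (pderiv q) 1 = \<gamma> y" by blast
    \<comment> \<open>The Leibniz rule for the differential of a product.\<close>
    let ?z = "scale (g \<gamma>) x + scale (f \<gamma>) y"
    have sc: "scale c x \<in> L" "scale c y \<in> L" for c
      using xy by (auto intro: subspace_scale[OF subspace_L])
    have "sym_act \<xi> (f * g) \<gamma> = \<gamma> (br \<xi> ?z)" if "\<xi> \<in> L" for \<xi>
      using derivationsD(4)[OF sym_act(1)[OF that, unfolded sym_alg_def] mult.hyps] xy that sc
        subspace_scale[OF subspace_L]
      by (simp add: br_add_right br_scale_right lin br_closed mult.commute)
    moreover have "poly p 1 = f \<gamma>" "poly q 1 = g \<gamma>" using pq(1)[of 1] pq(3)[of 1] one by auto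
    then have "poly (pderiv (p * q)) 1 = \<gamma> ?z"
      by (simp add: pderiv_mult pq lin(1)[OF sc] lin(2)[OF xy(1,1)] lin(2)[OF xy(2,2)] mult.commute)
    moreover have "(f * g) (fun_scale t \<gamma>) = poly (p * q) t" for t
      by (simp add: pq)
    moreover have "?z \<in> L" using sc by (intro subspace_add[OF subspace_L])
    ultimately show ?case by blast
  qed
qed

section \<open>The contact criterion and the choice of a contact form\<close>

lemma contactI:
  assumes dim: "dim L = 2 * n + 1" and \<gamma>: "\<gamma> \<in> dual" and x: "x \<in> stabiliser \<gamma>" "\<gamma> x \<noteq> 0"
    and v: "\<And>i. v i \<in> L" "alternation (2 * n) (pairing n (\<lambda>x y. - \<gamma> (br x y))) v \<noteq> 0"
  shows contact
proof -
  let ?B = "\<lambda>x y. - \<gamma> (br x y)"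
  have xL: "x \<in> L" using x(1) by (simp add: stabiliser_def)
  \<comment> \<open>The vector \<open>x\<close> fills the last slot of the top form, and the first
    \<open>2 * n\<close> entries stay those of \<open>v\<close>.\<close>
  define w where "w = v(2 * n := x)"
  have w: "w i \<in> L" for i using v xL by (simp add: w_def)
  have left: "\<gamma> (br x y) = 0" if "y \<in> L" for y using x(1) that by (simp add: stabiliser_def)
  then have right: "\<gamma> (br y x) = 0" if "y \<in> L" for y
    using that br_antisym[OF that xL] dual_minus[OF \<gamma> br_closed[OF xL that]] by simp
  have "differential \<gamma> = (\<lambda>v. ?B (v 0) (v 1))" by (simp add: differential_def)
  then have "wedge (n * 2) 1 (wedge_power 2 (differential \<gamma>) n) (\<lambda>v. \<gamma> (v 0)) w
      = inverse (2 ^ n) * alternation (2 * n + 1) (\<lambda>v. pairing n ?B v * \<gamma> (v (2 * n))) w"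
    by (simp only: wedge_power_pairing[of ?B] mult.commute[of n 2] wedge_alternation) simp
  also have "\<dots> = inverse (2 ^ n) * (alternation (2 * n) (pairing n ?B) w * \<gamma> (w (2 * n)))"
    using left[OF w] right[OF w] by (subst alternation_Suc_radical) (auto simp: w_def)
  also have "alternation (2 * n) (pairing n ?B) w = alternation (2 * n) (pairing n ?B) v"
    by (intro alternation_pairing_cong) (simp add: w_def)
  finally have "wedge (n * 2) 1 (wedge_power 2 (differential \<gamma>) n) (\<lambda>v. \<gamma> (v 0)) w \<noteq> 0"
    using v(2) x(2) by (simp add: w_def del: fun_upd_apply) (simp add: fun_upd_apply)
  then show ?thesis unfolding contact_def using dim \<gamma> w by blast
qed

text \<open>The minimum defining \<open>ind\<close> is attained, and the stabiliser of \<gamma> is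
  the radical of the form \<open>- \<gamma> (br x y)\<close>, so the rank formula applies. For index
  1 it also shows that the dimension is odd.\<close>

lemma ex_regular:
  "\<exists>\<gamma>\<in>dual. \<exists>n v. dim L = 2 * n + ind \<and> (\<forall>i. v i \<in> L) \<and>
    alternation (2 * n) (pairing n (\<lambda>x y. - \<gamma> (br x y))) v \<noteq> 0"
proof -
  interpret vector_space_char_0 scale by unfold_locales
  have "ind \<in> (\<lambda>\<gamma>. dim (stabiliser \<gamma>)) ` dual"
    unfolding ind_def using dual_zero by (intro Inf_nat_def1) auto
  then obtain \<gamma> where \<gamma>: "\<gamma> \<in> dual" "ind = dim (stabiliser \<gamma>)" by auto
  obtain A where A: "finite A" "L \<subseteq> span A" using finite_dim_L by auto
  have "\<gamma> 0 = 0" using \<gamma>(1) subspace_0[OF subspace_L] by (auto simp: dual_def) (metis mult_zero_left scale_zero_left)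
  then have "alternating_on L (\<lambda>x y. - \<gamma> (br x y))"
    using \<gamma>(1) br_closed
    by (auto simp: alternating_on_def dual_def br_alternating br_add_left br_add_right
        br_scale_left br_scale_right)
  from dim_eq_rank_plus_radical[OF subspace_L A(2,1) this] \<gamma> show ?thesis
    by (auto simp: stabiliser_def)
qed

theorem contact_if_nonconstant_invariant:
  assumes ind: "ind = 1" and F: "F \<in> sym_invariants" and nonconst: "\<not> F constant_on dual"
  shows contact
proof -
  let ?P = "\<lambda>\<gamma> n v. alternation (2 * n) (pairing n (\<lambda>x y. - \<gamma> (br x y))) v"
  have FS: "F \<in> sym_alg" and inv: "\<xi> \<in> L \<Longrightarrow> sym_act \<xi> F = 0" for \<xi>
    using F by (auto simp: sym_invariants_def)
  obtain \<gamma>0 n v where \<gamma>0: "\<gamma>0 \<in> dual" and dim: "dim L = 2 * n + 1" and v: "\<And>i. v i \<in> L"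
    and P0: "?P \<gamma>0 n v \<noteq> 0" using ex_regular ind by auto
  obtain \<gamma>1 where \<gamma>1: "\<gamma>1 \<in> dual" "F \<gamma>1 \<noteq> F 0" using nonconst by (auto simp: constant_on_def)
  \<comment> \<open>The line runs from \<gamma>0, where the alternation is non-zero, to \<gamma>1,
    where \<open>F\<close> differs from \<open>F 0\<close>; some point on it has both
    properties.\<close>
  define \<delta> where "\<delta> = \<gamma>1 + fun_scale (-1) \<gamma>0"
  have \<delta>: "\<delta> \<in> dual" unfolding \<delta>_def using \<gamma>0 \<gamma>1 by (intro dual_line)
  have ends: "\<gamma>0 + fun_scale 0 \<delta> = \<gamma>0" "\<gamma>0 + fun_scale 1 \<delta> = \<gamma>1"
    by (auto simp: \<delta>_def fun_scale_def)
  obtain p where p: "\<And>t. F (\<gamma>0 + fun_scale t \<delta>) = poly p t"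
    using sym_alg_line_poly[OF FS \<gamma>0 \<delta>] by auto
  obtain q where q: "\<And>t. ?P (\<gamma>0 + fun_scale t \<delta>) n v = poly q t"
    using ex_poly_alternation_pairing[of n "\<lambda>x y. - \<gamma>0 (br x y)" "\<lambda>x y. - \<delta> (br x y)" v]
    by (auto simp: fun_scale_def)
  have "poly (p - [:F 0:]) 1 \<noteq> 0" using \<gamma>1(2) p[of 1] ends by simp
  moreover have "poly q 0 \<noteq> 0" using P0 q[of 0] ends by simp
  ultimately obtain t where t: "poly (p - [:F 0:]) t \<noteq> 0" "poly q t \<noteq> 0"
    using ex_common_nonroot[of "p - [:F 0:]" q] by fastforce
  define \<gamma> where "\<gamma> = \<gamma>0 + fun_scale t \<delta>"
  have \<gamma>: "\<gamma> \<in> dual" and F\<gamma>: "F \<gamma> \<noteq> F 0" and P\<gamma>: "?P \<gamma> n v \<noteq> 0"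
    using t p q dual_line[OF \<gamma>0 \<delta>] by (auto simp: \<gamma>_def)
  obtain r where r: "\<And>s. F (fun_scale s \<gamma>) = poly r s"
    using ex_differential[OF FS \<gamma>] by blast
  have "fun_scale 1 \<gamma> = \<gamma>" "fun_scale 0 \<gamma> = 0" by (auto simp: fun_scale_def fun_eq_iff)
  \<comment> \<open>\<open>F\<close> takes different values at \<gamma> and at 0, so it is not
    constant on the ray and its radial derivative is not identically 0.\<close>
  then have "poly r 1 \<noteq> poly r 0" using r F\<gamma> by metis
  then have "pderiv r \<noteq> 0" by (metis pderiv_eq_0_iff degree_eq_zeroE poly_pCons mult_zero_right poly_0 add_0_right)
  \<comment> \<open>This second polynomial forces \<open>s\<close> to be non-zero, so that rescaling
    \<gamma> by \<open>s\<close> preserves the non-vanishing of the alternation.\<close>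
  moreover have "[:0, 1:] \<noteq> (0 :: 'k poly)" by simp
  ultimately obtain s where s: "poly (pderiv r) s \<noteq> 0" "poly [:0, 1:] s \<noteq> 0"
    using ex_common_nonroot by blast
  define \<alpha> where "\<alpha> = fun_scale s \<gamma>"
  have \<alpha>: "\<alpha> \<in> dual" unfolding \<alpha>_def by (rule dual_scale[OF \<gamma>])
  obtain x r' where x: "x \<in> L" "\<And>\<xi>. \<xi> \<in> L \<Longrightarrow> sym_act \<xi> F \<alpha> = \<alpha> (br \<xi> x)"
    and r': "\<And>u. F (fun_scale u \<alpha>) = poly r' u" "poly (pderiv r') 1 = \<alpha> x"
    using ex_differential[OF FS \<alpha>] by blast
  \<comment> \<open>The ray through \<alpha> is the ray through \<gamma> with its parameter
    multiplied by \<open>s\<close>; the chain rule then gives the factor \<open>s\<close> in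
    \<open>\<alpha> x\<close>.\<close>
  have "poly r' u = poly (pcompose r [:0, s:]) u" for u
    using r[of "u * s"] r'(1)[of u] by (simp add: \<alpha>_def fun_scale_def poly_pcompose mult.assoc)
  then have "r' = pcompose r [:0, s:]" by (simp add: poly_eq_poly_eq_iff[symmetric] fun_eq_iff)
  then have "\<alpha> x = poly (pderiv r) s * s"
    using r'(2) by (simp add: pderiv_pcompose poly_pcompose pderiv_pCons mult.commute)
  then have "\<alpha> x \<noteq> 0" using s by simp
  moreover have "x \<in> stabiliser \<alpha>"
  proof -
    \<comment> \<open>Invariance of \<open>F\<close> gives
      \<open>\<alpha> (br y x) = 0\<close>.\<close>
    have "\<alpha> (br x y) = 0" if y: "y \<in> L" for y
      using br_antisym[OF x(1) y] dual_minus[OF \<alpha> br_closed[OF y x(1)]] x(2)[OF y] inv[OF y] by simp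
    then show ?thesis using x(1) by (simp add: stabiliser_def)
  qed
  moreover have "?P \<alpha> n v = s ^ n * ?P \<gamma> n v"
    using alternation_pairing_scale[of n s "\<lambda>x y. - \<gamma> (br x y)" v] by (simp add: \<alpha>_def fun_scale_def)
  then have "?P \<alpha> n v \<noteq> 0" using P\<gamma> s(2) by simp
  ultimately show ?thesis using contactI[OF dim \<alpha>] v by blast
qed

end

section \<open>Application to the Lie algebra of an algebraic group\<close>

theorem proposition3p3:
  fixes Q :: "('k::{alg_closed_field, field_char_0} ^ 'n) monoid"
    and F :: "(((('k ^ 'n \<Rightarrow> 'k) \<Rightarrow> 'k ^ 'n \<Rightarrow> 'k) \<Rightarrow> 'k) \<Rightarrow> 'k)"
  assumes "affine_algebraic_group Q"
    and "connectedin zariski (carrier Q)"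
    and "fin_dim_lie_algebra.ind op_scale (lie Q) commutator = 1"
    and "F \<in> fin_dim_lie_algebra.sym_alg op_scale (lie Q)"
    and "\<not> F constant_on fin_dim_lie_algebra.dual op_scale (lie Q)"
    and "fin_dim_lie_algebra.sym_invariants op_scale (lie Q) commutator
           = fun_alg (fin_dim_lie_algebra.dual op_scale (lie Q)) {F}"
  shows "fin_dim_lie_algebra.contact op_scale (lie Q) commutator"
proof -
  interpret affine_algebraic_group Q by (rule assms(1))
  \<comment> \<open>\<open>F\<close> vanishes off \<open>lie.dual\<close>, so the generator of the
    ring on the right of the last assumption is \<open>F\<close> itself.\<close>
  have "on_set lie.dual F = F"
    using fun_alg_off assms(4) by (fastforce simp: on_set_def lie.sym_alg_def)
  then have "F \<in> lie.sym_invariants"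
    using assms(6) fun_alg.gen[of F "{F}" lie.dual] by simp
  then show ?thesis using lie.contact_if_nonconstant_invariant assms(3,5) by blast
qed

end
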